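(* Let $X,Y$ be Banach spaces and let $E:D(E)\subset X\to Y$, $A_0:D(A_0)\subset X\to Y$, $B_0:D(B_0)\subset X\to Y$ be linear operators such that $A_0$ is closed; $B_0$ is bounded; $D(E)\subset D(A_0)$ and $E$ is bijective; and $E^{-1}:Y\to D(E)\subset X$ is compact. Put $A:=A_0E^{-1}\in\mathscr{B}(Y)$ and $B:=B_0E^{-1}\in\mathscr{B}(Y)$, and assume $[A,B]:=AB-BA=0$. Let $1<\alpha\le2$, $0<\beta\le1$, $\eta,\hat\eta\in Y$, and let $g:\mathbb{J}\to Y$ be continuous. A mild solution $y(\cdot)\in\mathbb{C}^2(\mathbb{J},X)$ of the Cauchy problem $$\left({}^{C}D^{\alpha}_{0+}Ey\right)(t)-A_0\left({}^{C}D^{\beta}_{0+}y\right)(t)=B_0y(t)+g(t),\quad t>0,\qquad Ey(0)=\eta,\quad Ey'(0)=\hat\eta,$$ is given, for $t>0$, by $$\begin{aligned}y(t)&=\big(E^{-1}+t^{\alpha}E^{-1}BE_{\alpha-\beta,\alpha,\alpha+1}(At^{\alpha-\beta},Bt^{\alpha})\big)\eta+tE^{-1}E_{\alpha-\beta,\alpha,2}(At^{\alpha-\beta},Bt^{\alpha})\hat\eta\\&\quad+t^{\alpha-1}E^{-1}E_{\alpha-\beta,\alpha,\alpha}(At^{\alpha-\beta},Bt^{\alpha})\ast g(t)\\&=\Big(E^{-1}+\sum_{k=0}^{\infty}\sum_{m=0}^{\infty}\binom{k+m}{m}E^{-1}A^kB^{m+1}\frac{t^{k(\alpha-\beta)+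m\alpha+\alpha}}{\Gamma(k(\alpha-\beta)+m\alpha+\alpha+1)}\Big)\eta\\&\quad+\sum_{k=0}^{\infty}\sum_{m=0}^{\infty}\binom{k+m}{m}E^{-1}A^kB^m\frac{t^{k(\alpha-\beta)+m\alpha+1}}{\Gamma(k(\alpha-\beta)+m\alpha+2)}\hat\eta\\&\quad+\int_0^t\sum_{k=0}^{\infty}\sum_{m=0}^{\infty}\binom{k+m}{m}E^{-1}A^kB^m\frac{(t-s)^{k(\alpha-\beta)+m\alpha+\alpha-1}}{\Gamma(k(\alpha-\beta)+m\alpha+\alpha)}g(s)\,ds.\end{aligned}$$
   Context: $\mathscr{B}(Y)$ denotes the bounded linear operators on $Y$, $\mathbb{J}=[0,T]$, and $\mathbb{C}^2(\mathbb{J},X)$ the twice continuously differentiable functions $\mathbb{J}\to X$. $B_0E^{-1}$ is understood as an everywhere defined operator on $Y$ (so implicitly $D(E)\subset D(B_0)$). For $n-1<\nu\le n$, $n\in\mathbb{N}$, the Caputo derivative is $({}^{C}D^{\nu}_{0+}x)(t)=\frac{1}{\Gamma(n-\nu)}\int_0^t(t-s)^{n-\nu-1}x^{(n)}(s)\,ds$ (Bochner integral), understood as $x^{(n)}(t)$ when $\nu=n$. The symbol $\ast$ denotes Laplace convolution, $(F\ast g)(t)=\int_0^tF(t-s)g(s)\,ds$. A mild solution of the Cauchy problem for $y$ is a function $y=E^{-1}x$, where $x\in\mathbb{C}^2(\mathbb{J},Y)$ solves the transformed problem $({}^{C}D^{\alpha}_{0+}x)(t)-A({}^{C}D^{\beta}_{0+}x)(t)=Bx(t)+g(t)$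 for $t>0$, $x(0)=\eta$, $x'(0)=\hat\eta$. For commuting $A,B\in\mathscr{B}(Y)$, $a,b>0$, $c\in\mathbb{R}$ (three subscripts distinguish this function from the operator $E$): $$E_{a,b,c}(At^{a},Bt^{b})=\sum_{k=0}^{\infty}\sum_{m=0}^{\infty}\binom{k+m}{m}A^kB^m\frac{t^{ka+mb}}{\Gamma(ka+mb+c)}\in\mathscr{B}(Y).$$ *)

theory Defs
  imports "HOL-Analysis.Analysis"
begin

section \<open>Partially defined linear operators\<close>

text \<open>
  A linear operator \<open>D \<subset> X \<rightarrow> Y\<close> is represented by its domain and a total function,
  whose values outside the domain are irrelevant. Only real scalar multiplication is used,
  so that complex Banach spaces are covered as well.
\<close>

definition linear_op :: "'a::real_vector set \<Rightarrow> ('a \<Rightarrow> 'b::real_vector) \<Rightarrow> bool" where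
  "linear_op D f \<longleftrightarrow> subspace D \<and>
     (\<forall>x\<in>D. \<forall>y\<in>D. f (x + y) = f x + f y) \<and> (\<forall>c. \<forall>x\<in>D. f (c *\<^sub>R x) = c *\<^sub>R f x)"

definition closed_op :: "'a::real_normed_vector set \<Rightarrow> ('a \<Rightarrow> 'b::real_normed_vector) \<Rightarrow> bool" where
  "closed_op D f \<longleftrightarrow> closed {(x, f x) | x. x \<in> D}"

definition bounded_op :: "'a::real_normed_vector set \<Rightarrow> ('a \<Rightarrow> 'b::real_normed_vector) \<Rightarrow> bool" where
  "bounded_op D f \<longleftrightarrow> (\<exists>C. \<forall>x\<in>D. norm (f x) \<le> C * norm x)"

definition compact_op :: "('a::real_normed_vector \<Rightarrow> 'b::real_normed_vector) \<Rightarrow> bool" where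
  "compact_op f \<longleftrightarrow> linear f \<and> (\<forall>S. bounded S \<longrightarrow> compact (closure (f ` S)))"

primrec blinfun_pow :: "('a::real_normed_vector \<Rightarrow>\<^sub>L 'a) \<Rightarrow> nat \<Rightarrow> ('a \<Rightarrow>\<^sub>L 'a)" where
  "blinfun_pow A 0 = id_blinfun"
| "blinfun_pow A (Suc n) = A o\<^sub>L blinfun_pow A n"


section \<open>Bochner integral\<close>

text \<open>
  The Bochner integral of the library requires a second countable range type, which would
  exclude non-separable Banach spaces. The following is the library's definition of
  \<open>has_bochner_integral\<close> without that restriction: for a function that is a limit in mean of
  simple functions, Borel measurability and a.e. strong measurability agree up to null sets.
\<close>

definition has_bochner :: "'a measure \<Rightarrow> ('a \<Rightarrow> 'b::real_normed_vector) \<Rightarrow> 'b \<Rightarrow> bool" where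
  "has_bochner M f I \<longleftrightarrow> f \<in> borel_measurable M \<and>
     (\<exists>s. (\<forall>i. Bochner_Integration.simple_bochner_integrable M (s i)) \<and>
          (\<lambda>i. \<integral>\<^sup>+x. ennreal (norm (f x - s i x)) \<partial>M) \<longlonglongrightarrow> 0 \<and>
          (\<lambda>i::nat. Bochner_Integration.simple_bochner_integral M (s i)) \<longlonglongrightarrow> I)"

definition bochner_integrable :: "'a measure \<Rightarrow> ('a \<Rightarrow> 'b::real_normed_vector) \<Rightarrow> bool" where
  "bochner_integrable M f \<longleftrightarrow> (\<exists>I. has_bochner M f I)"

definition bochner_integral :: "'a measure \<Rightarrow> ('a \<Rightarrow> 'b::real_normed_vector) \<Rightarrow> 'b" where
  "bochner_integral M f = (if bochner_integrable M f then THE I. has_bochner M f I else 0)"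

definition laplace_conv ::
  "(real \<Rightarrow> 'a::real_normed_vector \<Rightarrow>\<^sub>L 'b::real_normed_vector) \<Rightarrow> (real \<Rightarrow> 'a) \<Rightarrow> real \<Rightarrow> 'b" where
  "laplace_conv F g t =
     bochner_integral (lebesgue_on {0..t}) (\<lambda>s. blinfun_apply (F (t - s)) (g s))"


section \<open>Derivatives on an interval and the Caputo derivative\<close>

text \<open>Derivatives are relative to \<open>J\<close>, hence one-sided at the end points of an interval.\<close>

primrec vderiv_on :: "real set \<Rightarrow> nat \<Rightarrow> (real \<Rightarrow> 'a::real_normed_vector) \<Rightarrow> real \<Rightarrow> 'a" where
  "vderiv_on J 0 f = f"
| "vderiv_on J (Suc n) f = (\<lambda>t. vector_derivative (vderiv_on J n f) (at t within J))"

definition Ck_on :: "nat \<Rightarrow> real set \<Rightarrow> (real \<Rightarrow> 'a::real_normed_vector) \<Rightarrow> bool" where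
  "Ck_on n J f \<longleftrightarrow> (\<forall>k<n. vderiv_on J k f differentiable_on J) \<and> continuous_on J (vderiv_on J n f)"

text \<open>
  For \<open>\<nu> > 0\<close>, the integer \<open>n = \<lceil>\<nu>\<rceil>\<close> is the one with \<open>n - 1 < \<nu> \<le> n\<close>. The functions are
  defined on \<open>{0..T}\<close>.
\<close>

definition caputo :: "real \<Rightarrow> real \<Rightarrow> (real \<Rightarrow> 'a::real_normed_vector) \<Rightarrow> real \<Rightarrow> 'a" where
  "caputo T \<nu> x t =
     (let n = nat \<lceil>\<nu>\<rceil> in
      if \<nu> = real n then vderiv_on {0..T} n x t
      else (1 / Gamma (real n - \<nu>)) *\<^sub>R
           bochner_integral (lebesgue_on {0..t})
             (\<lambda>s. (t - s) powr (real n - \<nu> - 1) *\<^sub>R vderiv_on {0..T} n x s))"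


section \<open>Iterated series and the bivariate Mittag-Leffler operator function\<close>

definition summable2 :: "(nat \<Rightarrow> nat \<Rightarrow> 'a::real_normed_vector) \<Rightarrow> bool" where
  "summable2 f \<longleftrightarrow> (\<forall>k. summable (f k)) \<and> summable (\<lambda>k. \<Sum>m. f k m)"

definition suminf2 :: "(nat \<Rightarrow> nat \<Rightarrow> 'a::real_normed_vector) \<Rightarrow> 'a" where
  "suminf2 f = (\<Sum>k. \<Sum>m. f k m)"

text \<open>
  The general term of \<open>E\<^sub>a\<^sub>,\<^sub>b\<^sub>,\<^sub>c(P, Q)\<close>. For \<open>P = A t\<^sup>a\<close> and \<open>Q = B t\<^sup>b\<close> the factor
  \<open>t powr (k * a + m * b)\<close> comes from \<open>P\<^sup>k Q\<^sup>m\<close>; in this form the term for \<open>k = m = 0\<close> is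
  correct at \<open>t = 0\<close> too, whereas \<open>0 powr 0 = 0\<close>. At the poles of \<open>Gamma\<close> the library's
  \<open>Gamma z = 0\<close> and \<open>x / 0 = 0\<close> yield the usual convention \<open>1 / Gamma z = 0\<close>.
\<close>

definition mittag_leffler_term :: "real \<Rightarrow> real \<Rightarrow> real \<Rightarrow> ('a::real_normed_vector \<Rightarrow>\<^sub>L 'a) \<Rightarrow> ('a \<Rightarrow>\<^sub>L 'a) \<Rightarrow>
    nat \<Rightarrow> nat \<Rightarrow> ('a \<Rightarrow>\<^sub>L 'a)" where
  "mittag_leffler_term a b c P Q k m =
     (real ((k + m) choose m) / Gamma (real k * a + real m * b + c)) *\<^sub>R
       (blinfun_pow P k o\<^sub>L blinfun_pow Q m)"

definition mittag_leffler :: "real \<Rightarrow> real \<Rightarrow> real \<Rightarrow> ('a::real_normed_vector \<Rightarrow>\<^sub>L 'a) \<Rightarrow> ('a \<Rightarrow>\<^sub>L 'a) \<Rightarrow>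
    ('a \<Rightarrow>\<^sub>L 'a)" where
  "mittag_leffler a b c P Q = suminf2 (mittag_leffler_term a b c P Q)"


section \<open>Mild solutions\<close>

text \<open>
  \<open>y\<close> is a mild solution on \<open>{0..T}\<close> of
  \<open>D\<^sup>\<alpha>(E y) - A0 (D\<^sup>\<beta> y) = B0 y + g\<close>, \<open>E y(0) = \<eta>\<close>, \<open>E y'(0) = \<eta>'\<close>,
  where \<open>DE\<close> is the domain of the bijection \<open>E\<close> onto the whole space.
\<close>

definition mild_solution ::
  "real \<Rightarrow> real \<Rightarrow> real \<Rightarrow> 'x::real_normed_vector set \<Rightarrow> ('x \<Rightarrow> 'y::real_normed_vector) \<Rightarrow>
   ('x \<Rightarrow> 'y) \<Rightarrow> ('x \<Rightarrow> 'y) \<Rightarrow> (real \<Rightarrow> 'y) \<Rightarrow> 'y \<Rightarrow> 'y \<Rightarrow> (real \<Rightarrow> 'x) \<Rightarrow> bool" where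
  "mild_solution T \<alpha> \<beta> DE E A0 B0 g \<eta> \<eta>' y \<longleftrightarrow>
     (\<exists>x. Ck_on 2 {0..T} x \<and>
          (\<forall>t\<in>{0..T}. y t = inv_into DE E (x t)) \<and>
          (\<forall>t\<in>{0<..T}. caputo T \<alpha> x t - A0 (inv_into DE E (caputo T \<beta> x t))
                        = B0 (inv_into DE E (x t)) + g t) \<and>
          x 0 = \<eta> \<and> vderiv_on {0..T} 1 x 0 = \<eta>')"

end

theory Submission
  imports Defs
begin

text \<open>
  Write \<open>J\<^sup>p\<close> for the Riemann-Liouville fractional integral of order \<open>p\<close>, with \<open>J\<^sup>0 = 1\<close>. With
  \<open>A = A0 E\<^sup>-\<^sup>1\<close> and \<open>B = B0 E\<^sup>-\<^sup>1\<close> a mild solution is \<open>y = E\<^sup>-\<^sup>1 x\<close>, where \<open>x\<close> solves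
  \<open>J\<^sup>2\<^sup>-\<^sup>\<alpha> x'' - A J\<^sup>1\<^sup>-\<^sup>\<beta> x' = B x + g\<close>, because the Caputo derivatives of order \<open>\<alpha>\<close>
  and \<open>\<beta>\<close> are \<open>J\<^sup>2\<^sup>-\<^sup>\<alpha> x''\<close> and \<open>J\<^sup>1\<^sup>-\<^sup>\<beta> x'\<close>. Applying \<open>J\<^sup>\<alpha>\<close> and the semigroup law \<open>J\<^sup>p J\<^sup>q = J\<^sup>p\<^sup>+\<^sup>q\<close>
  (\<open>frac_int_frac_int\<close>) yields the Volterra equation
  \<open>x = f + A J\<^sup>a x + B J\<^sup>\<alpha> x\<close> with \<open>a = \<alpha> - \<beta>\<close> and
  \<open>f(t) = \<eta> + t \<eta>' - (A J\<^sup>a \<eta>)(t) + (J\<^sup>\<alpha> g)(t)\<close>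
  (\<open>fractional_cauchy_volterra\<close>).

  As \<open>A\<close> and \<open>B\<close> commute, the Neumann series of \<open>1 - A J\<^sup>a - B J\<^sup>\<alpha>\<close> is the double series of
  \<open>(k + m choose m) A\<^sup>k B\<^sup>m J\<^sup>k\<^sup>a\<^sup>+\<^sup>m\<^sup>\<alpha>\<close>, called the resolvent below. That it inverts the operator is
  Pascal's rule (\<open>resolvent_identity\<close>), so \<open>x\<close> is the resolvent of \<open>f\<close>; no separate uniqueness
  argument is needed. The terms with \<open>\<eta>\<close> and \<open>\<eta>'\<close> are fractional integrals of powers of \<open>t\<close> and
  give Mittag-Leffler functions at once. For the term with \<open>g\<close> the sum is moved under the
  integral (\<open>has_bochner_resolvent\<close>). Convergence everywhere rests on one estimate: because
  \<open>1 / Gamma\<close> decays faster than any geometric sequence, the terms are bounded by a constant times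
  \<open>(1/2)\<^sup>k (1/2)\<^sup>m\<close> (\<open>binomial_Gamma_bound\<close>).

  The values lie in arbitrary Banach spaces, so separability cannot be used in the integration theory.
  Its elementary part is developed for \<^const>\<open>has_bochner\<close>, and the analytic facts on \<open>J\<^sup>p\<close>
  (existence, continuity, semigroup law, fundamental theorem of calculus) are obtained by density from
  the monomials \<open>s ^ n *\<^sub>R c\<close>, where they are identities between Gamma values
  (\<open>continuous_on_density_induct\<close>). Boundedness of \<open>A\<close> is the closed graph theorem.
\<close>

section \<open>Bochner integrals in non-separable spaces\<close>

abbreviation "sb_integrable \<equiv> Bochner_Integration.simple_bochner_integrable"
abbreviation "sb_integral \<equiv> Bochner_Integration.simple_bochner_integral"

lemma ennreal_tendsto_0_le:
  fixes f g :: "'a \<Rightarrow> ennreal"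
  assumes "\<And>i. f i \<le> g i" "(g \<longlongrightarrow> 0) F"
  shows "(f \<longlongrightarrow> 0) F"
  by (rule tendsto_sandwich[OF _ _ tendsto_const assms(2)]) (use assms in auto)

lemma simple_bochner_integrableD [dest]:
  "sb_integrable M s \<Longrightarrow> simple_function M s"
  by (auto elim: simple_bochner_integrable.cases)

text \<open>
  The space of values need not be second countable, so a sum or difference of two measurable
  functions need not be measurable. If one of the functions is simple there is no difficulty: the
  domain splits into finitely many measurable pieces on which that function is constant.
\<close>

lemma borel_measurable_op_simple:
  fixes f :: "'a \<Rightarrow> 'b::topological_space" and s :: "'a \<Rightarrow> 'c"
    and h :: "'b \<Rightarrow> 'c \<Rightarrow> 'd::topological_space"
  assumes f: "f \<in> borel_measurable M" and s: "simple_function M s"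
    and h: "\<And>y. continuous_on UNIV (\<lambda>z. h z y)"
  shows "(\<lambda>x. h (f x) (s x)) \<in> borel_measurable M"
proof (rule borel_measurableI, goal_cases)
  case U: (1 U)
  have "(\<lambda>x. h (f x) (s x)) -` U \<inter> space M =
      (\<Union>y\<in>s ` space M. (s -` {y} \<inter> space M) \<inter> (f -` ((\<lambda>z. h z y) -` U) \<inter> space M))"
    by auto
  also have "\<dots> \<in> sets M"
  proof (rule sets.finite_UN)
    show "finite (s ` space M)" using s by (auto simp: simple_function_def)
    fix y assume "y \<in> s ` space M"
    then have 1: "s -` {y} \<inter> space M \<in> sets M" using s by (auto simp: simple_function_def)
    have "open ((\<lambda>z. h z y) -` U)" using h[of y] U by (simp add: continuous_on_open_vimage)
    then have "f -` ((\<lambda>z. h z y) -` U) \<inter> space M \<in> sets M"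
      using f by (auto intro: measurable_sets)
    with 1 show "(s -` {y} \<inter> space M) \<inter> (f -` ((\<lambda>z. h z y) -` U) \<inter> space M) \<in> sets M"
      by (rule sets.Int)
  qed
  finally show ?case .
qed

lemma borel_measurable_norm_diff_simple:
  fixes f :: "'a \<Rightarrow> 'b::real_normed_vector"
  assumes f: "f \<in> borel_measurable M" and s: "sb_integrable M s"
  shows "(\<lambda>x. norm (f x - s x)) \<in> borel_measurable M"
proof -
  have "continuous_on UNIV (\<lambda>z::'b. norm (z - y))" for y
    by (intro continuous_intros)
  then show ?thesis
    using borel_measurable_op_simple[of f M s "\<lambda>z y. norm (z - y)"] f s by blast
qed

lemma norm_simple_integral_diff_le:
  fixes f :: "'a \<Rightarrow> 'b::real_normed_vector"
  assumes f: "f \<in> borel_measurable M"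
    and s: "sb_integrable M s" and t: "sb_integrable M t"
  shows "ennreal (norm (sb_integral M s - sb_integral M t)) \<le>
    (\<integral>\<^sup>+ x. norm (f x - s x) \<partial>M) + (\<integral>\<^sup>+ x. norm (f x - t x) \<partial>M)"
proof -
  have "ennreal (norm (sb_integral M s - sb_integral M t))
      = norm (sb_integral M (\<lambda>x. s x - t x))"
    using s t by (subst simple_bochner_integral_diff) auto
  also have "\<dots> \<le> sb_integral M (\<lambda>x. norm (s x - t x))"
    using simple_bochner_integrable_compose2[of "(-)" M "s" "t"] s t
    by (auto intro!: simple_bochner_integral_norm_bound)
  also have "\<dots> = (\<integral>\<^sup>+x. norm (s x - t x) \<partial>M)"
    using simple_bochner_integrable_compose2[of "\<lambda>x y. norm (x - y)" M "s" "t"] s t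
    by (auto intro!: simple_bochner_integral_eq_nn_integral)
  also have "\<dots> \<le> (\<integral>\<^sup>+x. ennreal (norm (f x - s x)) + ennreal (norm (f x - t x)) \<partial>M)"
  proof (intro nn_integral_mono)
    fix x
    have "norm (s x - t x) \<le> norm (f x - s x) + norm (f x - t x)"
      using norm_triangle_ineq4[of "f x - t x" "f x - s x"] by simp
    then show "ennreal (norm (s x - t x)) \<le> ennreal (norm (f x - s x)) + ennreal (norm (f x - t x))"
      by (simp add: ennreal_leI flip: ennreal_plus)
  qed
  also have "\<dots> = (\<integral>\<^sup>+ x. norm (f x - s x) \<partial>M) + (\<integral>\<^sup>+ x. norm (f x - t x) \<partial>M)"
    using borel_measurable_norm_diff_simple[OF f s] borel_measurable_norm_diff_simple[OF f t]
    by (intro nn_integral_add) auto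
  finally show ?thesis .
qed

text \<open>
  Naming the approximating sequence turns the existential quantifier over sequences in
  \<^const>\<open>has_bochner\<close> into a first-order one.
\<close>

definition bochner_approx where
  "bochner_approx M f I s \<longleftrightarrow> f \<in> borel_measurable M \<and> (\<forall>i. sb_integrable M (s i)) \<and>
     (\<lambda>i. \<integral>\<^sup>+x. ennreal (norm (f x - s i x)) \<partial>M) \<longlonglongrightarrow> 0 \<and>
     (\<lambda>i::nat. sb_integral M (s i)) \<longlonglongrightarrow> I"

lemma has_bochner_iff: "has_bochner M f I \<longleftrightarrow> (\<exists>s. bochner_approx M f I s)"
  by (simp add: has_bochner_def bochner_approx_def)

lemma has_bochnerI:
  assumes "f \<in> borel_measurable M" "\<And>i::nat. sb_integrable M (s i)"
    and "(\<lambda>i. \<integral>\<^sup>+x. ennreal (norm (f x - s i x)) \<partial>M) \<longlonglongrightarrow> 0"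
    and "(\<lambda>i. sb_integral M (s i)) \<longlonglongrightarrow> I"
  shows "has_bochner M f I"
  unfolding has_bochner_def by (intro conjI exI[of _ s] allI assms)

text \<open>
  This estimate carries the whole integration theory: the distance between a Bochner integral and the
  integral of any simple function is at most the mean distance of the integrands. The norm bound is the
  case of the zero function, and uniqueness follows by inserting the approximating sequence of one value
  of the integral into the estimate for the other.
\<close>

lemma has_bochner_simple_diff_le:
  assumes f: "has_bochner M f I" and t: "sb_integrable M t"
  shows "ennreal (norm (I - sb_integral M t)) \<le> (\<integral>\<^sup>+ x. norm (f x - t x) \<partial>M)"
proof -
  from f obtain s where "bochner_approx M f I s"
    unfolding has_bochner_iff by blast
  then have f: "f \<in> borel_measurable M" and s: "\<And>i. sb_integrable M (s i)"
    and l: "(\<lambda>i. \<integral>\<^sup>+x. ennreal (norm (f x - s i x)) \<partial>M) \<longlonglongrightarrow> 0"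
    and I: "(\<lambda>i::nat. sb_integral M (s i)) \<longlonglongrightarrow> I"
    by (auto simp: bochner_approx_def)
  have "(\<lambda>i. ennreal (norm (sb_integral M (s i) - sb_integral M t)))
      \<longlonglongrightarrow> ennreal (norm (I - sb_integral M t))"
    using I by (intro tendsto_intros)
  moreover have "(\<lambda>i. (\<integral>\<^sup>+x. ennreal (norm (f x - s i x)) \<partial>M) + (\<integral>\<^sup>+ x. norm (f x - t x) \<partial>M))
      \<longlonglongrightarrow> 0 + (\<integral>\<^sup>+ x. norm (f x - t x) \<partial>M)"
    by (intro tendsto_add l tendsto_const)
  ultimately show ?thesis
    using norm_simple_integral_diff_le[OF f s t] by (auto intro: LIMSEQ_le)
qed

lemma has_bochner_norm_le:
  assumes "has_bochner M f I"
  shows "ennreal (norm I) \<le> (\<integral>\<^sup>+ x. norm (f x) \<partial>M)"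
proof -
  have "sb_integrable M (\<lambda>x. 0::'b)"
    by (rule simple_bochner_integrable.intros) auto
  moreover have "sb_integral M (\<lambda>x. 0::'b) = 0"
    by (auto simp: simple_bochner_integral_def intro!: sum.neutral)
  ultimately show ?thesis using has_bochner_simple_diff_le[OF assms, of "\<lambda>x. 0"] by simp
qed

lemma has_bochner_unique:
  assumes "has_bochner M f I" "has_bochner M f I'"
  shows "I = I'"
proof -
  from assms(1) obtain s where "bochner_approx M f I s"
    unfolding has_bochner_iff by blast
  then have f: "f \<in> borel_measurable M" and s: "\<And>i. sb_integrable M (s i)"
    and l: "(\<lambda>i. \<integral>\<^sup>+x. ennreal (norm (f x - s i x)) \<partial>M) \<longlonglongrightarrow> 0"
    and I: "(\<lambda>i::nat. sb_integral M (s i)) \<longlonglongrightarrow> I"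
    by (auto simp: bochner_approx_def)
  have "(\<lambda>i. ennreal (norm (I' - sb_integral M (s i)))) \<longlonglongrightarrow> ennreal (norm (I' - I))"
    using I by (intro tendsto_intros)
  then have "ennreal (norm (I' - I)) \<le> 0"
    by (rule LIMSEQ_le[OF _ l]) (use has_bochner_simple_diff_le[OF assms(2) s] in blast)
  then show ?thesis by simp
qed

lemma bochner_integral_eq: "has_bochner M f I \<Longrightarrow> bochner_integral M f = I"
  unfolding bochner_integral_def bochner_integrable_def
  by (metis has_bochner_unique the_equality)

text \<open>
  Measurability of the sum is a separate hypothesis because it is not automatic for values in a
  non-separable space.
\<close>

lemma has_bochner_add:
  assumes "has_bochner M f I" "has_bochner M g J"
    and fg: "(\<lambda>x. f x + g x) \<in> borel_measurable M"
  shows "has_bochner M (\<lambda>x. f x + g x) (I + J)"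
proof -
  from assms(1) obtain s where "bochner_approx M f I s"
    unfolding has_bochner_iff by blast
  then have f: "f \<in> borel_measurable M" and s: "\<And>i. sb_integrable M (s i)"
    and l: "(\<lambda>i. \<integral>\<^sup>+x. ennreal (norm (f x - s i x)) \<partial>M) \<longlonglongrightarrow> 0"
    and I: "(\<lambda>i::nat. sb_integral M (s i)) \<longlonglongrightarrow> I"
    by (auto simp: bochner_approx_def)
  from assms(2) obtain r where "bochner_approx M g J r"
    unfolding has_bochner_iff by blast
  then have g: "g \<in> borel_measurable M" and r: "\<And>i. sb_integrable M (r i)"
    and m: "(\<lambda>i. \<integral>\<^sup>+x. ennreal (norm (g x - r i x)) \<partial>M) \<longlonglongrightarrow> 0"
    and J: "(\<lambda>i::nat. sb_integral M (r i)) \<longlonglongrightarrow> J"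
    by (auto simp: bochner_approx_def)
  have "(\<integral>\<^sup>+x. norm (f x + g x - (s i x + r i x)) \<partial>M) \<le>
      (\<integral>\<^sup>+x. norm (f x - s i x) \<partial>M) + (\<integral>\<^sup>+x. norm (g x - r i x) \<partial>M)" for i
  proof -
    have "(\<integral>\<^sup>+x. norm (f x + g x - (s i x + r i x)) \<partial>M) \<le>
        (\<integral>\<^sup>+x. ennreal (norm (f x - s i x)) + ennreal (norm (g x - r i x)) \<partial>M)"
      by (intro nn_integral_mono) (simp add: norm_diff_triangle_ineq flip: ennreal_plus)
    also have "\<dots> = (\<integral>\<^sup>+x. norm (f x - s i x) \<partial>M) + (\<integral>\<^sup>+x. norm (g x - r i x) \<partial>M)"
      using borel_measurable_norm_diff_simple[OF f s] borel_measurable_norm_diff_simple[OF g r]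
      by (intro nn_integral_add) auto
    finally show ?thesis .
  qed
  moreover have "(\<lambda>i. (\<integral>\<^sup>+x. norm (f x - s i x) \<partial>M) + (\<integral>\<^sup>+x. norm (g x - r i x) \<partial>M)) \<longlonglongrightarrow> 0"
    using tendsto_add[OF l m] by simp
  ultimately have "(\<lambda>i. \<integral>\<^sup>+x. norm (f x + g x - (s i x + r i x)) \<partial>M) \<longlonglongrightarrow> 0"
    by (rule ennreal_tendsto_0_le)
  moreover have "(\<lambda>i. sb_integral M (\<lambda>x. s i x + r i x)) \<longlonglongrightarrow> I + J"
    using tendsto_add[OF I J] by (simp add: simple_bochner_integral_add s r)
  moreover have "sb_integrable M (\<lambda>x. s i x + r i x)" for i
    using simple_bochner_integrable_compose2[of "(+)" M "s i" "r i"] s r by simp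
  ultimately show ?thesis by (rule has_bochnerI[OF fg, rotated 1])
qed

lemma has_bochner_bounded_linear:
  assumes T: "bounded_linear T" and "has_bochner M f I"
  shows "has_bochner M (\<lambda>x. T (f x)) (T I)"
proof -
  interpret T: bounded_linear T by fact
  from assms(2) obtain s where "bochner_approx M f I s"
    unfolding has_bochner_iff by blast
  then have f: "f \<in> borel_measurable M" and s: "\<And>i. sb_integrable M (s i)"
    and l: "(\<lambda>i. \<integral>\<^sup>+x. ennreal (norm (f x - s i x)) \<partial>M) \<longlonglongrightarrow> 0"
    and I: "(\<lambda>i::nat. sb_integral M (s i)) \<longlonglongrightarrow> I"
    by (auto simp: bochner_approx_def)
  have m: "(\<lambda>x. T (f x)) \<in> borel_measurable M"
    using f by (rule measurable_compose)
       (intro borel_measurable_continuous_onI T.continuous_on continuous_on_id)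
  obtain K where K: "K > 0" "\<And>x. norm (T x) \<le> norm x * K" using T.pos_bounded by blast
  have "(\<integral>\<^sup>+x. norm (T (f x) - T (s i x)) \<partial>M) \<le> ennreal K * (\<integral>\<^sup>+x. norm (f x - s i x) \<partial>M)" for i
  proof -
    have "(\<integral>\<^sup>+x. norm (T (f x) - T (s i x)) \<partial>M) \<le> (\<integral>\<^sup>+x. ennreal K * ennreal (norm (f x - s i x)) \<partial>M)"
      using K by (intro nn_integral_mono) (auto simp: ac_simps ennreal_mult[symmetric] simp flip: T.diff)
    also have "\<dots> = ennreal K * (\<integral>\<^sup>+x. norm (f x - s i x) \<partial>M)"
      using borel_measurable_norm_diff_simple[OF f s] by (intro nn_integral_cmult) auto
    finally show ?thesis .
  qed
  moreover have "(\<lambda>i. ennreal K * (\<integral>\<^sup>+x. norm (f x - s i x) \<partial>M)) \<longlonglongrightarrow> 0"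
    using ennreal_tendsto_cmult[OF _ l] by simp
  ultimately have "(\<lambda>i. \<integral>\<^sup>+x. norm (T (f x) - T (s i x)) \<partial>M) \<longlonglongrightarrow> 0"
    by (rule ennreal_tendsto_0_le)
  moreover have "(\<lambda>i. sb_integral M (\<lambda>x. T (s i x))) \<longlonglongrightarrow> T I"
    using T.tendsto[OF I] by (simp add: simple_bochner_integral_linear s T.linear_axioms)
  moreover have "sb_integrable M (\<lambda>x. T (s i x))" for i
    using simple_bochner_integrable_compose2[of "\<lambda>x y. T x" M "s i" "s i"] s by (simp add: T.zero)
  ultimately show ?thesis by (rule has_bochnerI[OF m, rotated 1])
qed

lemma has_bochner_real:
  assumes "has_bochner_integral M f (I::real)"
  shows "has_bochner M f I"
  using assms unfolding has_bochner_def by (auto elim!: has_bochner_integral.cases)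

lemma has_bochner_real_scaleR:
  assumes "has_bochner_integral M f (I::real)"
  shows "has_bochner M (\<lambda>x. f x *\<^sub>R c) (I *\<^sub>R c)"
  by (rule has_bochner_bounded_linear[OF bounded_linear_scaleR_left has_bochner_real[OF assms]])

lemma has_bochner_cong:
  assumes "\<And>x. x \<in> space M \<Longrightarrow> f x = g x"
  shows "has_bochner M f I \<longleftrightarrow> has_bochner M g I"
proof -
  have "f \<in> borel_measurable M \<longleftrightarrow> g \<in> borel_measurable M"
    using assms by (rule measurable_cong)
  moreover have "(\<integral>\<^sup>+x. ennreal (norm (f x - s i x)) \<partial>M) = (\<integral>\<^sup>+x. ennreal (norm (g x - s i x)) \<partial>M)"
    for s :: "nat \<Rightarrow> _" and i
    using assms by (intro nn_integral_cong) simp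
  ultimately show ?thesis unfolding has_bochner_def by simp
qed

lemma bochner_integral_cong:
  assumes "\<And>x. x \<in> space M \<Longrightarrow> f x = g x"
  shows "bochner_integral M f = bochner_integral M g"
  proof -
  have "has_bochner M f = has_bochner M g" by (intro ext has_bochner_cong assms)
  then show ?thesis unfolding bochner_integral_def bochner_integrable_def by (simp only:)
qed

text \<open>
  Integrals of functions that converge to \<open>f\<close> at a rate \<open>d i\<close>, relative to a fixed integrable weight
  \<open>w\<close>, converge to an integral of \<open>f\<close>. The weight is what permits singular kernels: a uniform limit of
  the regular factors is controlled after multiplication by the kernel. Existence of the limit comes from
  completeness, since the simple approximants of the approximants form a Cauchy sequence of integrals.
\<close>

lemma has_bochner_limit:
  fixes f :: "'a \<Rightarrow> 'b::banach"
  assumes f: "f \<in> borel_measurable M"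
    and fi: "\<And>i::nat. has_bochner M (F i) (I i)"
    and w: "w \<in> borel_measurable M" "(\<integral>\<^sup>+x. ennreal (w x) \<partial>M) = ennreal W"
    and le: "\<And>i x. x \<in> space M \<Longrightarrow> norm (f x - F i x) \<le> d i * w x"
    and d: "d \<longlonglongrightarrow> 0" "\<And>i. 0 \<le> d i" and w0: "\<And>x. x \<in> space M \<Longrightarrow> 0 \<le> w x"
  shows "\<exists>J. I \<longlonglongrightarrow> J \<and> has_bochner M f J"
proof -
  \<comment> \<open>One simple function for each approximant, with an error that tends to zero.\<close>
  have "\<exists>s. sb_integrable M s \<and> (\<integral>\<^sup>+x. norm (F i x - s x) \<partial>M) < ennreal (inverse (Suc i))" for i
  proof -
    from fi[of i] obtain s where "bochner_approx M (F i) (I i) s"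
      unfolding has_bochner_iff by blast
    then have "F i \<in> borel_measurable M" and s: "\<And>j. sb_integrable M (s j)"
      and l: "(\<lambda>j::nat. \<integral>\<^sup>+x. ennreal (norm (F i x - s j x)) \<partial>M) \<longlonglongrightarrow> 0"
      and "(\<lambda>i::nat. sb_integral M (s i)) \<longlonglongrightarrow> I i"
      by (auto simp: bochner_approx_def)
    have "eventually (\<lambda>j. (\<integral>\<^sup>+x. ennreal (norm (F i x - s j x)) \<partial>M) < ennreal (inverse (Suc i))) sequentially"
      using l by (rule order_tendstoD) simp
    then show ?thesis using s by (auto simp: eventually_sequentially)
  qed
  then obtain s where s: "\<And>i. sb_integrable M (s i)"
    and sF: "\<And>i. (\<integral>\<^sup>+x. norm (F i x - s i x) \<partial>M) < ennreal (inverse (Suc i))" by metis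
  have Fm: "F i \<in> borel_measurable M" for i using fi[of i] by (simp add: has_bochner_def)
  define b where "b i = inverse (real (Suc i)) + max 0 W * d i" for i
  have b0: "0 \<le> b i" for i using d(2) by (simp add: b_def)
  have b: "b \<longlonglongrightarrow> 0"
    unfolding b_def using tendsto_add[OF LIMSEQ_inverse_real_of_nat tendsto_mult_right_zero[OF d(1)]] by simp
  have W: "(\<integral>\<^sup>+x. ennreal (c * w x) \<partial>M) = ennreal (c * max 0 W)" if "0 \<le> c" for c
  proof -
    have "(\<integral>\<^sup>+x. ennreal (c * w x) \<partial>M) = (\<integral>\<^sup>+x. ennreal c * ennreal (w x) \<partial>M)"
      using that w0 by (intro nn_integral_cong) (simp add: ennreal_mult)
    also have "\<dots> = ennreal c * ennreal W" using w by (simp add: nn_integral_cmult)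
    also have "\<dots> = ennreal (c * max 0 W)" using that by (auto simp: ennreal_mult max_def ennreal_neg)
    finally show ?thesis .
  qed
  have near: "(\<integral>\<^sup>+x. norm (f x - s i x) \<partial>M) \<le> ennreal (b i)" for i
  proof -
    have "(\<integral>\<^sup>+x. norm (f x - s i x) \<partial>M) \<le> (\<integral>\<^sup>+x. ennreal (norm (F i x - s i x)) + ennreal (d i * w x) \<partial>M)"
    proof (rule nn_integral_mono)
      fix x assume x: "x \<in> space M"
      have "norm (f x - s i x) \<le> norm (F i x - s i x) + norm (f x - F i x)"
        using norm_triangle_ineq[of "f x - F i x" "F i x - s i x"] by simp
      also have "\<dots> \<le> norm (F i x - s i x) + d i * w x" using le[OF x] by simp
      finally show "ennreal (norm (f x - s i x)) \<le> ennreal (norm (F i x - s i x)) + ennreal (d i * w x)"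
        using d(2) w0[OF x] by (simp add: ennreal_leI flip: ennreal_plus)
    qed
    also have "\<dots> = (\<integral>\<^sup>+x. norm (F i x - s i x) \<partial>M) + (\<integral>\<^sup>+x. ennreal (d i * w x) \<partial>M)"
      using borel_measurable_norm_diff_simple[OF Fm s] w(1) by (intro nn_integral_add) auto
    also have "\<dots> \<le> ennreal (inverse (Suc i)) + ennreal (d i * max 0 W)"
      using sF[of i] W[OF d(2)] by (intro add_mono) auto
    also have "\<dots> = ennreal (b i)" using d(2) by (simp add: b_def mult.commute flip: ennreal_plus)
    finally show ?thesis .
  qed
  have "Cauchy (\<lambda>i. sb_integral M (s i))"
  proof (rule metric_CauchyI)
    fix e :: real assume e: "0 < e"
    have "eventually (\<lambda>i. b i < e/2) sequentially" using b e by (intro order_tendstoD) auto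
    then obtain N where N: "\<And>i. N \<le> i \<Longrightarrow> b i < e/2" by (auto simp: eventually_sequentially)
    show "\<exists>N. \<forall>m\<ge>N. \<forall>n\<ge>N. dist (sb_integral M (s m)) (sb_integral M (s n)) < e"
    proof (intro exI allI impI)
      fix m n assume "N \<le> m" "N \<le> n"
      then have *: "b m + b n < e" using N[of m] N[of n] by simp
      have "ennreal (norm (sb_integral M (s m) - sb_integral M (s n)))
          \<le> ennreal (b m) + ennreal (b n)"
        using norm_simple_integral_diff_le[OF f s s, of m n] near[of m] near[of n]
        by (meson add_mono order_trans)
      then have "norm (sb_integral M (s m) - sb_integral M (s n)) \<le> b m + b n"
        using b0 by (simp flip: ennreal_plus)
      with * show "dist (sb_integral M (s m)) (sb_integral M (s n)) < e"
        by (simp add: dist_norm)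
    qed
  qed
  then obtain J where J: "(\<lambda>i. sb_integral M (s i)) \<longlonglongrightarrow> J"
    using Cauchy_convergent convergent_def by blast
  have "(\<lambda>i. \<integral>\<^sup>+x. norm (f x - s i x) \<partial>M) \<longlonglongrightarrow> 0"
    by (rule ennreal_tendsto_0_le[OF near]) (use tendsto_ennrealI[OF b] in simp)
  then have hb: "has_bochner M f J" by (rule has_bochnerI[OF f s _ J])
  have "(\<lambda>i. I i - sb_integral M (s i)) \<longlonglongrightarrow> 0"
  proof (rule Lim_null_comparison)
    have "norm (I i - sb_integral M (s i)) \<le> inverse (real (Suc i))" for i
    proof -
      have "ennreal (norm (I i - sb_integral M (s i))) \<le> ennreal (inverse (real (Suc i)))"
        using has_bochner_simple_diff_le[OF fi s, of i i] less_imp_le[OF sF[of i]] by (rule order_trans)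
      then show ?thesis by (subst (asm) ennreal_le_iff) (auto simp del: of_nat_Suc)
    qed
    then show "eventually (\<lambda>i. norm (I i - sb_integral M (s i)) \<le> inverse (real (Suc i))) sequentially"
      by simp
  qed (rule LIMSEQ_inverse_real_of_nat)
  from tendsto_add[OF this J] have "I \<longlonglongrightarrow> J" by simp
  with hb show ?thesis by blast
qed

section \<open>Density of vector-valued polynomials\<close>

text \<open>
  A continuous curve has compact range, so finitely many points \<open>c\<close> of the range form an
  \<open>e/2\<close>-net. Tent functions of the distance from \<open>h s\<close> to \<open>c\<close>, normalised to sum to one, give a convex
  combination of net points that only involves points within \<open>e/2\<close> of \<open>h s\<close>.
\<close>

lemma continuous_on_partition_of_unity:
  fixes h :: "real \<Rightarrow> 'b::real_normed_vector"
  assumes h: "continuous_on {0..T} h" and e: "0 < e"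
  obtains C \<phi> where "finite C" "\<And>c. continuous_on {0..T} (\<phi> c :: real \<Rightarrow> real)"
    "\<And>s. s \<in> {0..T} \<Longrightarrow> norm (h s - (\<Sum>c\<in>C. \<phi> c s *\<^sub>R c)) < e"
proof -
  have "compact (h ` {0..T})" using h by (intro compact_continuous_image) auto
  then obtain C where C: "finite C" "h ` {0..T} \<subseteq> (\<Union>c\<in>C. ball c (e/2))"
    using seq_compact_imp_totally_bounded[of "h ` {0..T}"] e
    by (meson compact_imp_seq_compact half_gt_zero)
  define b where "b c s = max 0 (e/2 - dist c (h s))" for c s
  define B where "B s = (\<Sum>c\<in>C. b c s)" for s
  have b0: "0 \<le> b c s" for c s by (simp add: b_def)
  have bc: "continuous_on {0..T} (b c)" for c
    unfolding b_def by (intro continuous_intros h)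
  have B: "0 < B s" if "s \<in> {0..T}" for s
  proof -
    obtain c where c: "c \<in> C" "dist c (h s) < e/2" using C(2) \<open>s \<in> {0..T}\<close> by force
    then have "0 < b c s" by (simp add: b_def)
    also have "b c s \<le> B s" unfolding B_def using C(1) c(1) b0 by (intro member_le_sum) auto
    finally show ?thesis .
  qed
  show ?thesis
  proof
    show "finite C" by (rule C(1))
    show "continuous_on {0..T} (\<lambda>s. b c s / B s)" for c
      using B unfolding B_def by (intro continuous_intros bc) force
    fix s assume s: "s \<in> {0..T}"
    have one: "(\<Sum>c\<in>C. b c s / B s) = 1"
      using B[OF s] by (simp add: B_def flip: sum_divide_distrib)
    have "h s - (\<Sum>c\<in>C. (b c s / B s) *\<^sub>R c) = (\<Sum>c\<in>C. (b c s / B s) *\<^sub>R (h s - c))"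
      using one by (simp add: scaleR_diff_right sum_subtractf flip: scaleR_sum_left)
    also have "norm \<dots> \<le> (\<Sum>c\<in>C. (b c s / B s) * (e/2))"
    proof (rule sum_norm_le)
      fix c assume "c \<in> C"
      show "norm ((b c s / B s) *\<^sub>R (h s - c)) \<le> (b c s / B s) * (e/2)"
      proof (cases "dist c (h s) < e/2")
        case True
        then have "norm (h s - c) \<le> e/2" by (simp add: dist_norm norm_minus_commute)
        then have "(b c s / B s) * norm (h s - c) \<le> (b c s / B s) * (e/2)"
          using b0[of c s] B[OF s] by (intro mult_left_mono) auto
        then show ?thesis using b0[of c s] B[OF s] by simp
      next
        case False then show ?thesis by (simp add: b_def)
      qed
    qed
    also have "\<dots> = (\<Sum>c\<in>C. b c s / B s) * (e/2)" by (simp add: sum_distrib_right)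
    also have "\<dots> = e/2" by (simp add: one)
    finally show "norm (h s - (\<Sum>c\<in>C. (b c s / B s) *\<^sub>R c)) < e" using e by simp
  qed
qed

text \<open>
  Vector-valued polynomials are uniformly dense in the continuous functions: the partition of unity
  reduces the claim to products of a scalar function and a constant vector, and Stone-Weierstrass
  approximates the scalar factors. As an induction rule this says that a property of continuous functions
  that is stable under sums and uniform limits only has to be checked for monomials. Explicit monomial
  computations thereby replace vector-valued versions of Fubini's theorem.
\<close>

theorem continuous_on_density_induct [consumes 1, case_names monomial add limit]:
  fixes h :: "real \<Rightarrow> 'b::real_normed_vector"
  assumes h: "continuous_on {0..T} h"
    and mono: "\<And>n c. Q (\<lambda>s. s ^ n *\<^sub>R c)"
    and add: "\<And>f g. continuous_on {0..T} f \<Longrightarrow> continuous_on {0..T} g \<Longrightarrow> Q f \<Longrightarrow> Q g \<Longrightarrow>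
      Q (\<lambda>s. f s + g s)"
    and lim: "\<And>F f. (\<And>i::nat. continuous_on {0..T} (F i)) \<Longrightarrow> continuous_on {0..T} f \<Longrightarrow>
      (\<And>i. Q (F i)) \<Longrightarrow> (\<And>i s. s \<in> {0..T} \<Longrightarrow> norm (f s - F i s) < inverse (real (Suc i))) \<Longrightarrow> Q f"
  shows "Q h"
proof -
  have poly: "Q (\<lambda>s. (\<Sum>i\<le>n. a i * s ^ i) *\<^sub>R c)" for a :: "nat \<Rightarrow> real" and n c
  proof (induction n)
    case 0 then show ?case using mono[of 0 "a 0 *\<^sub>R c"] by simp
  next
    case (Suc n)
    have "Q (\<lambda>s. (\<Sum>i\<le>n. a i * s ^ i) *\<^sub>R c + s ^ Suc n *\<^sub>R (a (Suc n) *\<^sub>R c))"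
      by (intro add Suc mono continuous_intros)
    then show ?case by (simp add: scaleR_left_distrib mult.commute)
  qed
  have real: "Q (\<lambda>s. \<phi> s *\<^sub>R c)" if \<phi>: "continuous_on {0..T} \<phi>" for \<phi> :: "real \<Rightarrow> real" and c
  proof -
    have "\<exists>p. real_polynomial_function p \<and>
        (\<forall>s\<in>{0..T}. \<bar>\<phi> s - p s\<bar> < inverse (real (Suc i)) / (norm c + 1))" for i
    proof -
      have "0 < inverse (real (Suc i)) / (norm c + 1)"
        by (intro divide_pos_pos add_nonneg_pos) auto
      from Stone_Weierstrass_real_polynomial_function[OF _ \<phi> this] show ?thesis
        by (metis compact_Icc)
    qed
    then obtain p where p: "\<And>i. real_polynomial_function (p i)"
      and ps: "\<And>i s. s \<in> {0..T} \<Longrightarrow> \<bar>\<phi> s - p i s\<bar> < inverse (real (Suc i)) / (norm c + 1)"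
      by metis
    show ?thesis
    proof (rule lim)
      show "continuous_on {0..T} (\<lambda>s. p i s *\<^sub>R c)" for i
        using continuous_at_imp_continuous_on[of "{0..T}" "p i"] continuous_real_polymonial_function[OF p]
        by (intro continuous_on_scaleR continuous_on_const) blast
      show "continuous_on {0..T} (\<lambda>s. \<phi> s *\<^sub>R c)" by (intro continuous_intros \<phi>)
      show "Q (\<lambda>s. p i s *\<^sub>R c)" for i
        using p[of i] poly by (auto simp: real_polynomial_function_iff_sum)
      show "norm (\<phi> s *\<^sub>R c - p i s *\<^sub>R c) < inverse (real (Suc i))" if s: "s \<in> {0..T}" for i s
      proof -
        have "norm (\<phi> s *\<^sub>R c - p i s *\<^sub>R c) = \<bar>\<phi> s - p i s\<bar> * norm c"
          by (simp flip: scaleR_diff_left)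
        also have "\<dots> \<le> \<bar>\<phi> s - p i s\<bar> * (norm c + 1)" by (intro mult_left_mono) auto
        also have "\<dots> < inverse (real (Suc i))"
          using ps[OF s, of i] by (simp add: pos_less_divide_eq add_nonneg_pos)
        finally show ?thesis .
      qed
    qed
  qed
  have sum: "Q (\<lambda>s. \<Sum>c\<in>C. \<phi> c s *\<^sub>R c)" if "finite C" "\<And>c. continuous_on {0..T} (\<phi> c :: real \<Rightarrow> real)" for C \<phi>
    using that(1)
  proof induction
    case empty then show ?case using mono[of 0 0] by simp
  next
    case (insert c C)
    have "Q (\<lambda>s. \<phi> c s *\<^sub>R c + (\<Sum>c\<in>C. \<phi> c s *\<^sub>R c))"
      by (intro add real insert.IH continuous_intros that)
    then show ?case using insert.hyps by simp
  qed
  have "\<exists>f. continuous_on {0..T} f \<and> Q f \<and> (\<forall>s\<in>{0..T}. norm (h s - f s) < inverse (real (Suc i)))" for i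
  proof -
    have "0 < inverse (real (Suc i))" by simp
    from continuous_on_partition_of_unity[OF h this] obtain C \<phi> where
      C: "finite C" "\<And>c. continuous_on {0..T} (\<phi> c :: real \<Rightarrow> real)"
      "\<And>s. s \<in> {0..T} \<Longrightarrow> norm (h s - (\<Sum>c\<in>C. \<phi> c s *\<^sub>R c)) < inverse (real (Suc i))" by metis
    have "continuous_on {0..T} (\<lambda>s. \<Sum>c\<in>C. \<phi> c s *\<^sub>R c)"
      by (intro continuous_intros C)
    with sum[of C \<phi>] C show ?thesis by blast
  qed
  then obtain f where f: "\<And>i. continuous_on {0..T} (f i)" "\<And>i. Q (f i)"
    "\<And>i s. s \<in> {0..T} \<Longrightarrow> norm (h s - f i s) < inverse (real (Suc i))" by metis
  show ?thesis by (rule lim[OF f(1) h f(2) f(3)])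
qed

section \<open>Integrals with power kernels\<close>

text \<open>
  The kernel \<open>(t - s) powr (p - 1)\<close> is singular at the right end point if \<open>p < 1\<close>, so continuity
  is only available on the half-open interval. The remaining point does not affect measurability.
\<close>

lemma borel_measurable_continuous_on_ivl_open:
  fixes f :: "real \<Rightarrow> 'b::topological_space"
  assumes "continuous_on {0..<t} f"
  shows "f \<in> borel_measurable (lebesgue_on {0..t})"
proof (rule borel_measurableI)
  fix U :: "'b set" assume "open U"
  from assms[unfolded continuous_on_open_invariant, rule_format, OF this]
  obtain V where V: "open V" "V \<inter> {0..<t} = f -` U \<inter> {0..<t}"
    by blast
  have "f -` U \<inter> {0..t} = (f -` U \<inter> {0..<t}) \<union> (f -` U \<inter> {t} \<inter> {0..t})"
    by force
  then have "f -` U \<inter> {0..t} = (V \<inter> {0..<t}) \<union> (f -` U \<inter> {t} \<inter> {0..t})"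
    by (simp only: V(2))
  moreover have "V \<inter> {0..<t} \<in> sets borel" using V(1) by auto
  moreover have "finite (f -` U \<inter> {t} \<inter> {0..t})" by simp
  then have "f -` U \<inter> {t} \<inter> {0..t} \<in> sets borel"
    by (intro borel_closed finite_imp_closed)
  ultimately have "f -` U \<inter> {0..t} \<in> sets borel" by (simp only: sets.Un)
  then have "f -` U \<inter> {0..t} \<in> sets lebesgue" by (simp add: sets_completionI_sets)
  then show "f -` U \<inter> space (lebesgue_on {0..t}) \<in> sets (lebesgue_on {0..t})"
    by (simp add: sets_restrict_space_iff)
qed

text \<open>
  The substitution \<open>s = t * u\<close> turns this into the Beta integral over the unit interval.
\<close>

lemma has_bochner_integral_Beta_kernel:
  fixes p r t :: real
  assumes p: "0 < p" and r: "0 \<le> r" and t: "0 \<le> t"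
  shows "has_bochner_integral (lebesgue_on {0..t}) (\<lambda>s. (t - s) powr (p - 1) * s powr r)
    (Gamma p * Gamma (r + 1) / Gamma (r + p + 1) * t powr (r + p))"
proof (cases "t = 0")
  case True
  have "has_bochner_integral (lebesgue_on {0..t}) (\<lambda>s. (t - s) powr (p - 1) * s powr r) 0"
  proof (rule has_bochner_integral_null)
    have "{0..t} = {0}" using True by auto
    then show "{0..t} \<in> null_sets lebesgue"
      using negligible_sing[of "0::real"] by (simp only: negligible_iff_null_sets)
  qed
  then show ?thesis using True by simp
next
  case False
  then have t: "0 < t" using t by simp
  have "((\<lambda>s. s powr r * (1 - s) powr (p - 1)) has_integral Beta (r + 1) p) {0..1}"
    using has_integral_Beta_real[of "r + 1" p] p r by simp
  then have "((\<lambda>s. s powr r * (1 - s) powr (p - 1)) has_integral Beta (r + 1) p) (cbox 0 1)"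
    by simp
  from has_integral_affinity'[OF this, of "1/t" 0] t
  have "((\<lambda>s. (s / t) powr r * (1 - s / t) powr (p - 1)) has_integral (Beta (r + 1) p * t)) {0..t}"
    by (simp add: mult.commute)
  from has_integral_mult_right[OF this, of "t powr (r + p - 1)"]
  have "((\<lambda>s. t powr (r + p - 1) * ((s / t) powr r * (1 - s / t) powr (p - 1))) has_integral
      t powr (r + p - 1) * (Beta (r + 1) p * t)) {0..t}" .
  moreover have "t powr (r + p - 1) * ((s / t) powr r * (1 - s / t) powr (p - 1)) =
      (t - s) powr (p - 1) * s powr r" if s: "s \<in> {0..t}" for s
  proof -
    have "1 - s / t = (t - s) / t" using t by (simp add: field_simps)
    then have "(s / t) powr r * (1 - s / t) powr (p - 1)
      = (t - s) powr (p - 1) * s powr r / (t powr r * t powr (p - 1))"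
      using s t by (simp add: powr_divide)
    also have "t powr r * t powr (p - 1) = t powr (r + p - 1)"
      by (simp add: algebra_simps flip: powr_add)
    finally show ?thesis using t by simp
  qed
  moreover have "t powr (r + p - 1) * (Beta (r + 1) p * t) =
      Gamma p * Gamma (r + 1) / Gamma (r + p + 1) * t powr (r + p)"
  proof -
    have "t powr (r + p - 1) * t = t powr (r + p)"
      using t powr_add[of t "r + p - 1" 1] by simp
    then show ?thesis by (simp add: Beta_def algebra_simps)
  qed
  ultimately have I: "((\<lambda>s. (t - s) powr (p - 1) * s powr r) has_integral
      Gamma p * Gamma (r + 1) / Gamma (r + p + 1) * t powr (r + p)) {0..t}"
    by (metis (no_types, lifting) has_integral_eq)
  then have "(\<lambda>s. (t - s) powr (p - 1) * s powr r) absolutely_integrable_on {0..t}"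
    by (intro nonnegative_absolutely_integrable_1) (auto simp: integrable_on_def)
  then have "integrable (lebesgue_on {0..t}) (\<lambda>s. (t - s) powr (p - 1) * s powr r)"
    by (simp add: set_integrable_def integrable_restrict_space)
  moreover from has_integral_integral_lebesgue_on[OF this] I
  have "integral\<^sup>L (lebesgue_on {0..t}) (\<lambda>s. (t - s) powr (p - 1) * s powr r) =
      Gamma p * Gamma (r + 1) / Gamma (r + p + 1) * t powr (r + p)"
    by (intro has_integral_unique) auto
  ultimately show ?thesis by (simp add: has_bochner_integral_iff)
qed

section \<open>Riemann-Liouville fractional integrals\<close>

text \<open>
  The Riemann-Liouville fractional integral of order \<open>p\<close>, with the identity at \<open>p = 0\<close>. This convention
  makes the Caputo derivative of order \<open>\<nu>\<close> equal to the fractional integral of order \<open>n - \<nu>\<close> of the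
  \<open>n\<close>-th derivative, also when \<open>\<nu>\<close> is an integer, and makes the semigroup law hold for all \<open>p, q \<ge> 0\<close>.
\<close>

definition frac_int :: "real \<Rightarrow> (real \<Rightarrow> 'a::real_normed_vector) \<Rightarrow> real \<Rightarrow> 'a" where
  "frac_int p h t = (if p = 0 then h t else
     (1 / Gamma p) *\<^sub>R bochner_integral (lebesgue_on {0..t}) (\<lambda>s. (t - s) powr (p - 1) *\<^sub>R h s))"

lemma Gamma_pos_nonzero: "0 < p \<Longrightarrow> Gamma p \<noteq> 0" for p :: real
  using Gamma_real_pos[of p] by (metis less_irrefl)

lemma continuous_on_kernel: "continuous_on {0..<t} (\<lambda>s. (t - s) powr q)" for q t :: real
  by (intro continuous_intros) auto

lemma borel_measurable_kernel_scaleR: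
  fixes h :: "real \<Rightarrow> 'a::real_normed_vector"
  assumes "continuous_on {0..T} h" "t \<le> T"
  shows "(\<lambda>s. (t - s) powr q *\<^sub>R h s) \<in> borel_measurable (lebesgue_on {0..t})"
  by (intro borel_measurable_continuous_on_ivl_open continuous_on_scaleR continuous_on_kernel
      continuous_on_subset[OF assms(1)]) (use assms(2) in auto)

text \<open>
  The values of \<open>\<phi>\<close> are prescribed for positive arguments only, because \<open>0 powr 0 = 0\<close>: in this form the
  formula also covers the constant function \<open>1\<close> with \<open>r = 0\<close>.
\<close>

lemma has_bochner_integral_kernel_powr:
  fixes p r t :: real
  assumes p: "0 < p" and r: "0 \<le> r" and t: "0 \<le> t"
    and \<phi>: "continuous_on {0..t} \<phi>" "\<And>s. 0 < s \<Longrightarrow> s \<le> t \<Longrightarrow> \<phi> s = s powr r"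
  shows "has_bochner_integral (lebesgue_on {0..t}) (\<lambda>s. (t - s) powr (p - 1) * \<phi> s)
    (Gamma p * Gamma (r + 1) / Gamma (r + p + 1) * t powr (r + p))"
proof (rule has_bochner_integralI_AE[OF has_bochner_integral_Beta_kernel[OF p r t]])
  show "(\<lambda>s. (t - s) powr (p - 1) * \<phi> s) \<in> borel_measurable (lebesgue_on {0..t})"
    using borel_measurable_kernel_scaleR[OF \<phi>(1) order_refl] by simp
  have "AE s in lebesgue. s \<noteq> (0::real)"
    by (intro AE_completion AE_lborel_singleton)
  then show "AE s in lebesgue_on {0..t}. (t - s) powr (p - 1) * s powr r = (t - s) powr (p - 1) * \<phi> s"
    using \<phi>(2) by (auto simp: AE_restrict_space_iff)
qed

text \<open>
  By density: for a monomial the integrand is a scalar function times a fixed vector, and the kernel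
  itself is the integrable weight in the limit step.
\<close>

lemma has_bochner_kernel_exists:
  fixes h :: "real \<Rightarrow> 'a::banach"
  assumes h: "continuous_on {0..T} h" and p: "0 < p" and t: "0 \<le> t" "t \<le> T"
  shows "\<exists>I. has_bochner (lebesgue_on {0..t}) (\<lambda>s. (t - s) powr (p - 1) *\<^sub>R h s) I"
  using h
proof (induction rule: continuous_on_density_induct)
  case (monomial n c)
  have "has_bochner_integral (lebesgue_on {0..t}) (\<lambda>s. (t - s) powr (p - 1) * s ^ n)
      (Gamma p * Gamma (real n + 1) / Gamma (real n + p + 1) * t powr (real n + p))"
    by (rule has_bochner_integral_kernel_powr)
       (use p t in \<open>auto intro!: continuous_intros simp: powr_realpow\<close>)
  from has_bochner_real_scaleR[OF this, of c] show ?case by auto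
next
  case (add f g)
  then obtain I J where
    "has_bochner (lebesgue_on {0..t}) (\<lambda>s. (t - s) powr (p - 1) *\<^sub>R f s) I"
    "has_bochner (lebesgue_on {0..t}) (\<lambda>s. (t - s) powr (p - 1) *\<^sub>R g s) J" by auto
  moreover have "(\<lambda>s. (t - s) powr (p - 1) *\<^sub>R (f s + g s)) \<in> borel_measurable (lebesgue_on {0..t})"
    by (rule borel_measurable_kernel_scaleR[OF continuous_on_add[OF add(1,2)] t(2)])
  ultimately show ?case
    using has_bochner_add by (force simp: scaleR_right_distrib)
next
  case (limit F f)
  from limit.IH obtain I where I: "\<And>i. has_bochner (lebesgue_on {0..t}) (\<lambda>s. (t - s) powr (p - 1) *\<^sub>R F i s) (I i)"
    by metis
  have w: "has_bochner_integral (lebesgue_on {0..t}) (\<lambda>s. (t - s) powr (p - 1) * 1)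
      (Gamma p * Gamma (0 + 1) / Gamma (0 + p + 1) * t powr (0 + p))"
    by (rule has_bochner_integral_kernel_powr) (use p t in auto)
  have "\<exists>J. I \<longlonglongrightarrow> J \<and> has_bochner (lebesgue_on {0..t}) (\<lambda>s. (t - s) powr (p - 1) *\<^sub>R f s) J"
  proof (rule has_bochner_limit[where w="\<lambda>s. (t - s) powr (p - 1)" and d="\<lambda>i. inverse (real (Suc i))"])
    show "(\<integral>\<^sup>+ x. ennreal ((t - x) powr (p - 1)) \<partial>lebesgue_on {0..t}) =
        ennreal (integral\<^sup>L (lebesgue_on {0..t}) (\<lambda>s. (t - s) powr (p - 1)))"
      using w by (intro nn_integral_eq_integral) (auto simp: has_bochner_integral_iff)
    show "(\<lambda>s. (t - s) powr (p - 1)) \<in> borel_measurable (lebesgue_on {0..t})"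
      by (intro borel_measurable_continuous_on_ivl_open continuous_on_kernel)
    fix i x assume x: "x \<in> space (lebesgue_on {0..t})"
    then have "norm (f x - F i x) \<le> inverse (real (Suc i))" using limit(3)[of x i] t by auto
    then have "(t - x) powr (p - 1) * norm (f x - F i x) \<le> (t - x) powr (p - 1) * inverse (real (Suc i))"
      by (intro mult_left_mono) auto
    then show "norm ((t - x) powr (p - 1) *\<^sub>R f x - (t - x) powr (p - 1) *\<^sub>R F i x)
        \<le> inverse (real (Suc i)) * (t - x) powr (p - 1)"
      by (simp add: mult.commute flip: scaleR_diff_right)
  qed (use borel_measurable_kernel_scaleR[OF limit(2) t(2)] I LIMSEQ_inverse_real_of_nat in auto)
  then show ?case by blast
qed

lemma has_bochner_frac_int:
  fixes h :: "real \<Rightarrow> 'a::banach"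
  assumes "continuous_on {0..T} h" "0 < p" "0 \<le> t" "t \<le> T"
  shows "has_bochner (lebesgue_on {0..t}) (\<lambda>s. (t - s) powr (p - 1) *\<^sub>R h s) (Gamma p *\<^sub>R frac_int p h t)"
proof -
  obtain I where I: "has_bochner (lebesgue_on {0..t}) (\<lambda>s. (t - s) powr (p - 1) *\<^sub>R h s) I"
    using has_bochner_kernel_exists[OF assms] by blast
  have "Gamma p \<noteq> 0" using Gamma_real_pos[OF assms(2)] by simp
  then have "Gamma p *\<^sub>R frac_int p h t = I"
    using assms(2) by (simp add: frac_int_def bochner_integral_eq[OF I])
  with I show ?thesis by simp
qed

lemma frac_int_eqI:
  fixes h :: "real \<Rightarrow> 'a::banach"
  assumes "0 < p" "has_bochner (lebesgue_on {0..t}) (\<lambda>s. (t - s) powr (p - 1) *\<^sub>R h s) (Gamma p *\<^sub>R I)"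
  shows "frac_int p h t = I"
  using assms bochner_integral_eq[OF assms(2)] Gamma_pos_nonzero[OF assms(1)] by (simp add: frac_int_def)

lemma frac_int_0 [simp]: "frac_int 0 h t = h t"
  by (simp add: frac_int_def)

lemma frac_int_cong:
  assumes "\<And>s. s \<in> {0..t} \<Longrightarrow> h s = k s" "0 \<le> t"
  shows "frac_int p h t = frac_int p k t"
proof -
  have "bochner_integral (lebesgue_on {0..t}) (\<lambda>s. (t - s) powr (p - 1) *\<^sub>R h s) =
      bochner_integral (lebesgue_on {0..t}) (\<lambda>s. (t - s) powr (p - 1) *\<^sub>R k s)"
    using assms(1) by (intro bochner_integral_cong) simp
  then show ?thesis using assms by (simp add: frac_int_def)
qed

lemma frac_int_add:
  fixes f g :: "real \<Rightarrow> 'a::banach"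
  assumes f: "continuous_on {0..T} f" and g: "continuous_on {0..T} g" and p: "0 \<le> p" and t: "0 \<le> t" "t \<le> T"
  shows "frac_int p (\<lambda>s. f s + g s) t = frac_int p f t + frac_int p g t"
proof (cases "p = 0")
  case False
  then have p: "0 < p" using p by simp
  have "(\<lambda>s. (t - s) powr (p - 1) *\<^sub>R f s + (t - s) powr (p - 1) *\<^sub>R g s) \<in> borel_measurable (lebesgue_on {0..t})"
    using borel_measurable_kernel_scaleR[OF continuous_on_add[OF f g] t(2)] by (simp add: scaleR_right_distrib)
  from has_bochner_add[OF has_bochner_frac_int[OF f p t] has_bochner_frac_int[OF g p t] this]
  show ?thesis by (intro frac_int_eqI[OF p]) (simp add: scaleR_right_distrib)
qed simp

lemma frac_int_bounded_linear:
  fixes h :: "real \<Rightarrow> 'a::banach" and L :: "'a \<Rightarrow> 'b::banach"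
  assumes L: "bounded_linear L" and h: "continuous_on {0..T} h" and p: "0 \<le> p" and t: "0 \<le> t" "t \<le> T"
  shows "frac_int p (\<lambda>s. L (h s)) t = L (frac_int p h t)"
proof (cases "p = 0")
  case False
  then have p: "0 < p" using p by simp
  interpret L: bounded_linear L by fact
  from has_bochner_bounded_linear[OF L has_bochner_frac_int[OF h p t]]
  show ?thesis by (intro frac_int_eqI[OF p]) (simp add: L.scaleR)
qed simp

lemma frac_int_diff:
  fixes f g :: "real \<Rightarrow> 'a::banach"
  assumes f: "continuous_on {0..T} f" and g: "continuous_on {0..T} g" and p: "0 \<le> p" and t: "0 \<le> t" "t \<le> T"
  shows "frac_int p (\<lambda>s. f s - g s) t = frac_int p f t - frac_int p g t"
  using frac_int_add[OF f continuous_on_minus[OF g] p t]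
    frac_int_bounded_linear[OF bounded_linear_minus[OF bounded_linear_ident] g p t] by simp

text \<open>
  Powers are mapped to powers. Together with density, this formula determines the fractional integrals
  completely.
\<close>

lemma frac_int_powr:
  fixes c :: "'a::banach"
  assumes "0 < p" "0 \<le> r" "0 \<le> t" "continuous_on {0..t} \<phi>" "\<And>s. 0 < s \<Longrightarrow> s \<le> t \<Longrightarrow> \<phi> s = s powr r"
  shows "frac_int p (\<lambda>s. \<phi> s *\<^sub>R c) t = (Gamma (r + 1) / Gamma (r + p + 1) * t powr (r + p)) *\<^sub>R c"
  using has_bochner_real_scaleR[OF has_bochner_integral_kernel_powr[OF assms], of c]
  by (intro frac_int_eqI assms) (simp add: field_simps)

lemma frac_int_monomial:
  fixes c :: "'a::banach"
  assumes "0 < p" "0 \<le> t"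
  shows "frac_int p (\<lambda>s. s ^ n *\<^sub>R c) t = (fact n / Gamma (n + p + 1) * t powr (n + p)) *\<^sub>R c"
  using frac_int_powr[OF assms(1) _ assms(2), of "real n" "\<lambda>s. s ^ n" c] assms
  by (simp add: powr_realpow continuous_intros Gamma_fact add.commute)

text \<open>
  The value at \<open>t > 0\<close> of the fractional integral of order \<open>p\<close> of the constant function \<open>1\<close>, hence
  the factor by which fractional integration at most enlarges a bound on \<open>[0, t]\<close>. The case distinction
  gives the value \<open>1\<close> at \<open>p = 0\<close> also for \<open>t = 0\<close>, where \<open>0 powr 0 = 0\<close>.
\<close>

definition frac_mass :: "real \<Rightarrow> real \<Rightarrow> real" where
  "frac_mass p t = (if p = 0 then 1 else t powr p / Gamma (p + 1))"

lemma frac_mass_nonneg: "0 \<le> p \<Longrightarrow> 0 \<le> frac_mass p t"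
  by (simp add: frac_mass_def Gamma_real_pos less_imp_le)

lemma frac_mass_mono: "0 \<le> p \<Longrightarrow> 0 \<le> t \<Longrightarrow> t \<le> T \<Longrightarrow> frac_mass p t \<le> frac_mass p T"
  by (simp add: frac_mass_def Gamma_real_pos less_imp_le divide_right_mono powr_mono2)

lemma norm_frac_int_le:
  fixes h :: "real \<Rightarrow> 'a::banach"
  assumes h: "continuous_on {0..T} h" and p: "0 \<le> p" and t: "0 \<le> t" "t \<le> T"
    and K: "\<And>s. s \<in> {0..t} \<Longrightarrow> norm (h s) \<le> K"
  shows "norm (frac_int p h t) \<le> K * frac_mass p t"
proof (cases "p = 0")
  case True then show ?thesis using K[of t] t by (simp add: frac_mass_def)
next
  case False
  then have p: "0 < p" using p by simp
  have "0 \<le> K" using K[of 0] t norm_ge_zero order_trans by (metis atLeastAtMost_iff order_refl)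
  have w: "has_bochner_integral (lebesgue_on {0..t}) (\<lambda>s. (t - s) powr (p - 1) * 1)
      (Gamma p * Gamma (0 + 1) / Gamma (0 + p + 1) * t powr (0 + p))"
    by (rule has_bochner_integral_kernel_powr) (use p t in auto)
  have "ennreal (norm (Gamma p *\<^sub>R frac_int p h t)) \<le>
      (\<integral>\<^sup>+ s. norm ((t - s) powr (p - 1) *\<^sub>R h s) \<partial>lebesgue_on {0..t})"
    by (rule has_bochner_norm_le[OF has_bochner_frac_int[OF h p t]])
  also have "\<dots> \<le> (\<integral>\<^sup>+ s. ennreal ((t - s) powr (p - 1) * K) \<partial>lebesgue_on {0..t})"
    using K by (intro nn_integral_mono ennreal_leI) (auto intro!: mult_left_mono)
  also have "\<dots> = ennreal (integral\<^sup>L (lebesgue_on {0..t}) (\<lambda>s. (t - s) powr (p - 1) * K))"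
    using w \<open>0 \<le> K\<close> by (intro nn_integral_eq_integral) (auto simp: has_bochner_integral_iff)
  also have "\<dots> = ennreal (Gamma p / Gamma (p + 1) * t powr p * K)"
    using w by (simp add: has_bochner_integral_iff)
  finally have "Gamma p * norm (frac_int p h t) \<le> Gamma p * (K * (t powr p / Gamma (p + 1)))"
    using p \<open>0 \<le> K\<close> Gamma_real_pos[of p] Gamma_real_pos[of "p + 1"]
    by (simp add: mult.commute mult.left_commute)
  then have "norm (frac_int p h t) \<le> K * (t powr p / Gamma (p + 1))"
    using Gamma_real_pos[OF p] by (rule mult_left_le_imp_le)
  then show ?thesis using p by (simp add: frac_mass_def)
qed

lemma frac_int_approx:
  fixes f k :: "real \<Rightarrow> 'a::banach"
  assumes f: "continuous_on {0..T} f" and k: "continuous_on {0..T} k" and p: "0 \<le> p" and t: "0 \<le> t" "t \<le> T"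
    and K: "\<And>s. s \<in> {0..T} \<Longrightarrow> norm (f s - k s) \<le> K" and "0 \<le> K"
  shows "norm (frac_int p f t - frac_int p k t) \<le> K * frac_mass p T"
proof -
  have "norm (frac_int p (\<lambda>s. f s - k s) t) \<le> K * frac_mass p t"
    using t by (intro norm_frac_int_le[OF continuous_on_diff[OF f k] p t] K) auto
  also have "\<dots> \<le> K * frac_mass p T" using frac_mass_mono[OF p t] \<open>0 \<le> K\<close> by (rule mult_left_mono)
  finally show ?thesis by (simp add: frac_int_diff[OF f k p t])
qed

lemma LIMSEQ_rate:
  fixes x :: "'a::real_normed_vector"
  assumes "\<And>i. norm (x - X i) \<le> inverse (real (Suc i)) * M"
  shows "X \<longlonglongrightarrow> x"
proof -
  have "(\<lambda>i. x - X i) \<longlonglongrightarrow> 0"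
    by (rule Lim_null_comparison[OF always_eventually[OF allI[OF assms]]])
       (rule tendsto_mult_left_zero[OF LIMSEQ_inverse_real_of_nat])
  from tendsto_diff[OF tendsto_const[of x] this] show ?thesis by simp
qed

text \<open>
  By density: powers are continuous, and the fractional integral maps uniform limits to uniform limits.
\<close>

lemma continuous_on_frac_int:
  fixes h :: "real \<Rightarrow> 'a::banach"
  assumes h: "continuous_on {0..T} h" and p: "0 \<le> p"
  shows "continuous_on {0..T} (frac_int p h)"
proof (cases "p = 0")
  case True then show ?thesis using h by simp
next
  case False
  with p have p: "0 < p" "0 \<le> p" by auto
  from h show ?thesis
  proof (induction rule: continuous_on_density_induct)
    case (monomial n c)
    have "continuous_on {0..T} (\<lambda>t. (fact n / Gamma (n + p + 1) * t powr (n + p)) *\<^sub>R c)"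
      using p by (intro continuous_intros continuous_on_powr') auto
    then show ?case
      by (rule continuous_on_eq) (rule frac_int_monomial[symmetric], use p in auto)
  next
    case (add f g)
    have "continuous_on {0..T} (\<lambda>t. frac_int p f t + frac_int p g t)"
      by (intro continuous_intros add)
    then show ?case by (rule continuous_on_eq) (use frac_int_add[OF add(1,2) p(2)] in auto)
  next
    case (limit F f)
    have "uniform_limit {0..T} (\<lambda>i. frac_int p (F i)) (frac_int p f) sequentially"
    proof (rule uniform_limitI)
      fix e :: real assume e: "0 < e"
      have "(\<lambda>i. inverse (real (Suc i)) * frac_mass p T) \<longlonglongrightarrow> 0"
        by (rule tendsto_mult_left_zero[OF LIMSEQ_inverse_real_of_nat])
      with e have "\<forall>\<^sub>F i in sequentially. inverse (real (Suc i)) * frac_mass p T < e"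
        by (intro order_tendstoD)
      then show "\<forall>\<^sub>F i in sequentially. \<forall>t\<in>{0..T}. dist (frac_int p (F i) t) (frac_int p f t) < e"
      proof eventually_elim
        case (elim i)
        show ?case
        proof
          fix t assume "t \<in> {0..T}"
          then have "norm (frac_int p f t - frac_int p (F i) t) \<le> inverse (real (Suc i)) * frac_mass p T"
            using limit(3)[of _ i]
            by (intro frac_int_approx[OF limit(2) limit(1) p(2)]) (auto intro: less_imp_le)
          with elim show "dist (frac_int p (F i) t) (frac_int p f t) < e"
            by (simp add: dist_norm norm_minus_commute)
        qed
      qed
    qed
    with limit.IH show ?case
      by (intro uniform_limit_theorem[where f="\<lambda>i. frac_int p (F i)" and F=sequentially]) auto
  qed
qed

text \<open>
  The semigroup law is usually proved by interchanging the order of integration in a double integral with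
  two singular kernels. By density it is enough to compare both sides on monomials, where the Gamma factors
  of the intermediate power cancel.
\<close>

theorem frac_int_frac_int:
  fixes h :: "real \<Rightarrow> 'a::banach"
  assumes h: "continuous_on {0..T} h" and p: "0 \<le> p" and q: "0 \<le> q" and t: "0 \<le> t" "t \<le> T"
  shows "frac_int p (frac_int q h) t = frac_int (p + q) h t"
proof (cases "p = 0 \<or> q = 0")
  case True then show ?thesis by (auto simp: frac_int_0[abs_def])
next
  case False
  with p q have pq: "0 < p" "0 < q" "0 \<le> p + q" by auto
  from h show ?thesis
  proof (induction rule: continuous_on_density_induct)
    case (monomial n c)
    let ?a = "fact n / Gamma (n + q + 1) :: real"
    have "frac_int p (frac_int q (\<lambda>s. s ^ n *\<^sub>R c)) t = frac_int p (\<lambda>s. s powr (n + q) *\<^sub>R (?a *\<^sub>R c)) t"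
      using t(1) pq frac_int_monomial[of q _ n c] by (intro frac_int_cong) (auto simp: mult.commute)
    also have "\<dots> = (Gamma (n + q + 1) / Gamma (n + q + p + 1) * t powr (n + q + p)) *\<^sub>R (?a *\<^sub>R c)"
      using pq t by (intro frac_int_powr continuous_on_powr' continuous_intros) auto
    also have "\<dots> = frac_int (p + q) (\<lambda>s. s ^ n *\<^sub>R c) t"
      using pq t Gamma_pos_nonzero[of "n + q + 1"] frac_int_monomial[of "p + q" t n c] by (simp add: add_ac)
    finally show ?case .
  next
    case (add f g)
    have "frac_int p (frac_int q (\<lambda>s. f s + g s)) t = frac_int p (\<lambda>s. frac_int q f s + frac_int q g s) t"
      using t pq by (intro frac_int_cong frac_int_add[OF add(1,2)]) auto
    also have "\<dots> = frac_int p (frac_int q f) t + frac_int p (frac_int q g) t"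
      using pq by (intro frac_int_add[where T=T] continuous_on_frac_int add t) auto
    also have "\<dots> = frac_int (p + q) (\<lambda>s. f s + g s) t"
      by (simp add: add.IH frac_int_add[OF add(1,2) pq(3) t])
    finally show ?case .
  next
    case (limit F f)
    have le: "norm (f s - F i s) \<le> inverse (real (Suc i))" if "s \<in> {0..T}" for i s
      using limit(3)[OF that, of i] by simp
    have q': "norm (frac_int q f s - frac_int q (F i) s) \<le> inverse (real (Suc i)) * frac_mass q T"
      if "s \<in> {0..T}" for i s
      using that by (intro frac_int_approx[OF limit(2) limit(1) q] le) auto
    have "(\<lambda>i. frac_int p (frac_int q (F i)) t) \<longlonglongrightarrow> frac_int p (frac_int q f) t"
    proof (rule LIMSEQ_rate)
      show "norm (frac_int p (frac_int q f) t - frac_int p (frac_int q (F i)) t)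
          \<le> inverse (real (Suc i)) * (frac_mass q T * frac_mass p T)" for i
        using frac_int_approx[OF continuous_on_frac_int[OF limit(2) q] continuous_on_frac_int[OF limit(1) q] p t,
            of i "inverse (real (Suc i)) * frac_mass q T"] q' frac_mass_nonneg[OF q, of T]
        by (simp add: mult.assoc del: of_nat_Suc)
    qed
    moreover have "(\<lambda>i. frac_int p (frac_int q (F i)) t) \<longlonglongrightarrow> frac_int (p + q) f t"
      unfolding limit.IH
      by (rule LIMSEQ_rate, rule frac_int_approx[OF limit(2) limit(1) pq(3) t]) (use le in auto)
    ultimately show ?case by (rule LIMSEQ_unique)
  qed
qed

text \<open>
  The Bochner integral and the Henstock-Kurzweil integral of a continuous function agree because they
  agree on monomials and both are continuous in the uniform norm. This gives access to the fundamental
  theorem of calculus.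
\<close>

lemma frac_int_1_eq_integral:
  fixes h :: "real \<Rightarrow> 'a::banach"
  assumes h: "continuous_on {0..T} h" and t: "0 \<le> t" "t \<le> T"
  shows "frac_int 1 h t = integral {0..t} h"
  using h
proof (induction rule: continuous_on_density_induct)
  case (monomial n c)
  have "((\<lambda>s. s ^ n *\<^sub>R c) has_integral (t ^ Suc n / Suc n) *\<^sub>R c - (0 ^ Suc n / Suc n) *\<^sub>R c) {0..t}"
  proof (intro fundamental_theorem_of_calculus t(1))
    fix s assume "s \<in> {0..t}"
    have "((\<lambda>s. s ^ Suc n / Suc n) has_real_derivative s ^ n) (at s within {0..t})"
      by (auto intro!: derivative_eq_intros simp del: of_nat_Suc power_Suc)
    then have "((\<lambda>s. s ^ Suc n / Suc n) has_vector_derivative s ^ n) (at s within {0..t})"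
      by (simp only: has_real_derivative_iff_has_vector_derivative)
    then show "((\<lambda>s. (s ^ Suc n / Suc n) *\<^sub>R c) has_vector_derivative s ^ n *\<^sub>R c) (at s within {0..t})"
      by (rule bounded_linear.has_vector_derivative[OF bounded_linear_scaleR_left])
  qed
  then have "integral {0..t} (\<lambda>s. s ^ n *\<^sub>R c) = (t ^ Suc n / Suc n) *\<^sub>R c"
    by (auto dest: integral_unique)
  moreover have "Gamma (real n + 1 + 1) = real (Suc n) * fact n"
    using Gamma_fact[of "Suc n", where ?'a=real] by (simp add: add_ac)
  moreover have "t powr (real n + 1) = t ^ Suc n"
    using t(1) powr_realpow[of t "Suc n"] by (cases "t = 0") (auto simp: add.commute)
  ultimately show ?case
    using frac_int_monomial[of 1 t n c] t by simp
next
  case (add f g)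
  have "f integrable_on {0..t}" "g integrable_on {0..t}"
    using t by (auto intro!: integrable_continuous_real continuous_on_subset[OF add(1)] continuous_on_subset[OF add(2)])
  then show ?case by (simp add: frac_int_add[OF add(1,2) _ t] add.IH integral_add)
next
  case (limit F f)
  have c: "continuous_on {0..t} f" "continuous_on {0..t} (F i)" for i
    using t by (auto intro: continuous_on_subset[OF limit(2)] continuous_on_subset[OF limit(1)])
  have le: "norm (f s - F i s) \<le> inverse (real (Suc i))" if "s \<in> {0..T}" for i s
    using limit(3)[OF that, of i] by simp
  have "(\<lambda>i. frac_int 1 (F i) t) \<longlonglongrightarrow> frac_int 1 f t"
    by (rule LIMSEQ_rate, rule frac_int_approx[OF limit(2) limit(1) _ t]) (use le in auto)
  moreover have "(\<lambda>i. frac_int 1 (F i) t) \<longlonglongrightarrow> integral {0..t} f"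
    unfolding limit.IH
  proof (rule LIMSEQ_rate)
    fix i
    have "norm (integral {0..t} (\<lambda>s. f s - F i s)) \<le> inverse (real (Suc i)) * (t - 0)"
      using t by (intro integral_bound continuous_intros c le) auto
    then show "norm (integral {0..t} f - integral {0..t} (F i)) \<le> inverse (real (Suc i)) * (t - 0)"
      using c by (simp add: integral_diff integrable_continuous_real)
  qed
  ultimately show ?case by (rule LIMSEQ_unique)
qed

lemma frac_int_1_derivative:
  fixes x :: "real \<Rightarrow> 'a::banach"
  assumes x: "\<And>s. s \<in> {0..T} \<Longrightarrow> (x has_vector_derivative x' s) (at s within {0..T})"
    and x': "continuous_on {0..T} x'" and t: "0 \<le> t" "t \<le> T"
  shows "frac_int 1 x' t = x t - x 0"
proof -
  have "(x' has_integral x t - x 0) {0..t}"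
    using t by (intro fundamental_theorem_of_calculus has_vector_derivative_within_subset[OF x]) auto
  then show ?thesis using frac_int_1_eq_integral[OF x' t] by (auto dest: integral_unique)
qed

section \<open>Geometrically dominated double series\<close>

text \<open>
  All series of the theorem are dominated by the same kind of geometric double series, which settles
  absolute convergence, interchange with integration and the truncation error at once.
\<close>

definition geom_dominated :: "(nat \<Rightarrow> nat \<Rightarrow> 'a::real_normed_vector) \<Rightarrow> bool" where
  "geom_dominated f \<longleftrightarrow> (\<exists>C. \<forall>k m. norm (f k m) \<le> C * (1/2) ^ k * (1/2) ^ m)"

lemma half_geometric_tail:
  fixes f :: "nat \<Rightarrow> 'a::banach"
  assumes f: "\<And>n. norm (f n) \<le> D * (1/2) ^ n"
  shows "summable f" "norm (suminf f - (\<Sum>n<N. f n)) \<le> 2 * D * (1/2) ^ N"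
proof -
  have g: "summable (\<lambda>n. D * (1/2::real) ^ n)" by (intro summable_mult summable_geometric) simp
  show s: "summable f" by (rule summable_comparison_test[OF _ g]) (use f in auto)
  have tail: "norm (f (n + N)) \<le> D * (1/2) ^ N * (1/2) ^ n" for n
    using f[of "n + N"] by (simp add: power_add mult_ac)
  have "suminf f - (\<Sum>n<N. f n) = (\<Sum>n. f (n + N))"
    using suminf_minus_initial_segment[OF s, of N] by simp
  also have "norm \<dots> \<le> (\<Sum>n. D * (1/2) ^ N * (1/2::real) ^ n)"
    by (rule norm_suminf_le[OF tail]) (intro summable_mult summable_geometric, simp)
  also have "\<dots> = D * (1/2) ^ N * 2"
    by (subst suminf_mult) (auto simp: suminf_geometric)
  finally show "norm (suminf f - (\<Sum>n<N. f n)) \<le> 2 * D * (1/2) ^ N" by (simp add: mult_ac)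
qed

lemma geom_dominated_row:
  fixes f :: "nat \<Rightarrow> nat \<Rightarrow> 'a::banach"
  assumes f: "\<And>k m. norm (f k m) \<le> C * (1/2) ^ k * (1/2) ^ m"
  shows "summable (f k)" "norm (\<Sum>m. f k m) \<le> 2 * C * (1/2) ^ k"
    "norm ((\<Sum>m. f k m) - (\<Sum>m<N. f k m)) \<le> 2 * C * (1/2) ^ N * (1/2) ^ k"
  using half_geometric_tail[of "f k" "C * (1/2) ^ k"] half_geometric_tail(2)[of "f k" "C * (1/2) ^ k" 0] f[of k]
  by (auto simp: mult_ac)

lemma geom_dominated_summable2:
  fixes f :: "nat \<Rightarrow> nat \<Rightarrow> 'a::banach"
  assumes "geom_dominated f"
  shows "summable2 f"
proof -
  obtain C where f: "\<And>k m. norm (f k m) \<le> C * (1/2) ^ k * (1/2) ^ m"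
    using assms by (auto simp: geom_dominated_def)
  show ?thesis
    unfolding summable2_def
    using geom_dominated_row(1)[OF f] half_geometric_tail(1)[OF geom_dominated_row(2)[OF f]] by blast
qed

text \<open>
  The error of the square partial sums depends only on the dominating constant. For a family of double
  series with a common constant the partial sums therefore converge uniformly.
\<close>

lemma suminf2_truncation:
  fixes f :: "nat \<Rightarrow> nat \<Rightarrow> 'a::banach"
  assumes f: "\<And>k m. norm (f k m) \<le> C * (1/2) ^ k * (1/2) ^ m"
  shows "norm (suminf2 f - (\<Sum>k<N. \<Sum>m<N. f k m)) \<le> 8 * C * (1/2) ^ N"
proof -
  have C: "0 \<le> C" using order_trans[OF norm_ge_zero f[of 0 0]] by simp
  have "norm (suminf2 f - (\<Sum>k<N. \<Sum>m. f k m)) \<le> 2 * (2 * C) * (1/2) ^ N"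
    unfolding suminf2_def by (rule half_geometric_tail(2)[OF geom_dominated_row(2)[OF f]])
  moreover have "norm ((\<Sum>k<N. \<Sum>m. f k m) - (\<Sum>k<N. \<Sum>m<N. f k m)) \<le> 4 * C * (1/2) ^ N"
  proof -
    have "norm ((\<Sum>k<N. \<Sum>m. f k m) - (\<Sum>k<N. \<Sum>m<N. f k m))
        = norm (\<Sum>k<N. (\<Sum>m. f k m) - (\<Sum>m<N. f k m))"
      by (simp add: sum_subtractf)
    also have "\<dots> \<le> (\<Sum>k<N. 2 * C * (1/2) ^ N * (1/2) ^ k)"
      by (rule sum_norm_le) (rule geom_dominated_row(3)[OF f])
    also have "\<dots> = 2 * C * (1/2) ^ N * (\<Sum>k<N. (1/2) ^ k)" by (simp add: sum_distrib_left)
    also have "\<dots> \<le> 2 * C * (1/2) ^ N * 2"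
      using C by (intro mult_left_mono) (auto simp: sum_gp_strict)
    finally show ?thesis by simp
  qed
  ultimately show ?thesis
    using norm_triangle_ineq[of "suminf2 f - (\<Sum>k<N. \<Sum>m. f k m)"
        "(\<Sum>k<N. \<Sum>m. f k m) - (\<Sum>k<N. \<Sum>m<N. f k m)"] by simp
qed

lemma summable2_bounded_linear:
  fixes f :: "nat \<Rightarrow> nat \<Rightarrow> 'a::real_normed_vector"
  assumes L: "bounded_linear L" and f: "summable2 f"
  shows "summable2 (\<lambda>k m. L (f k m))" "suminf2 (\<lambda>k m. L (f k m)) = L (suminf2 f)"
proof -
  have rows: "\<And>k. summable (f k)" and total: "summable (\<lambda>k. \<Sum>m. f k m)"
    using f by (auto simp: summable2_def)
  have eq: "(\<Sum>m. L (f k m)) = L (\<Sum>m. f k m)" for k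
    by (rule bounded_linear.suminf[OF L rows, symmetric])
  show "summable2 (\<lambda>k m. L (f k m))"
    unfolding summable2_def eq
    by (intro conjI allI bounded_linear.summable[OF L] rows total)
  show "suminf2 (\<lambda>k m. L (f k m)) = L (suminf2 f)"
    unfolding suminf2_def eq by (rule bounded_linear.suminf[OF L total, symmetric])
qed

lemma suminf2_add:
  assumes "summable2 f" "summable2 g"
  shows "suminf2 (\<lambda>k m. f k m + g k m) = suminf2 f + suminf2 g"
  using assms by (simp add: summable2_def suminf2_def suminf_add flip: suminf_add)

text \<open>
  Pascal's rule in summed form. The coefficient \<open>(k + m) choose m\<close> counts the monotone lattice paths
  from the origin to \<open>(k, m)\<close>; a path is empty or its last step goes in one of the two directions. Hence
  the double series of \<open>v\<close> reproduces itself from its two shifts, up to the term at the origin.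
\<close>

theorem suminf2_pascal:
  fixes v :: "nat \<Rightarrow> nat \<Rightarrow> 'a::real_normed_vector"
  assumes F: "summable2 (\<lambda>k m. real ((k + m) choose m) *\<^sub>R v k m)"
    and G: "summable2 (\<lambda>k m. real ((k + m) choose m) *\<^sub>R v (Suc k) m)"
    and H: "summable2 (\<lambda>k m. real ((k + m) choose m) *\<^sub>R v k (Suc m))"
  shows "suminf2 (\<lambda>k m. real ((k + m) choose m) *\<^sub>R v k m) =
    v 0 0 + suminf2 (\<lambda>k m. real ((k + m) choose m) *\<^sub>R v (Suc k) m)
          + suminf2 (\<lambda>k m. real ((k + m) choose m) *\<^sub>R v k (Suc m))"
proof -
  define f where "f k m = real ((k + m) choose m) *\<^sub>R v k m" for k m
  define g where "g k m = real ((k + m) choose m) *\<^sub>R v (Suc k) m" for k m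
  define h where "h k m = real ((k + m) choose m) *\<^sub>R v k (Suc m)" for k m
  have f: "summable (f k)" "summable (\<lambda>k. \<Sum>m. f k m)"
    and g: "summable (g k)" "summable (\<lambda>k. \<Sum>m. g k m)"
    and h: "summable (h k)" "summable (\<lambda>k. \<Sum>m. h k m)" for k
    using F G H by (auto simp: summable2_def f_def[abs_def] g_def[abs_def] h_def[abs_def])
  have zero: "(\<Sum>m. f 0 m) = v 0 0 + (\<Sum>m. h 0 m)"
  proof -
    have "f 0 0 = v 0 0" "\<And>m. f 0 (Suc m) = h 0 m" by (simp_all add: f_def h_def)
    then show ?thesis using suminf_split_head[OF f(1)[of 0]] by simp
  qed
  have step: "(\<Sum>m. f (Suc k) m) = (\<Sum>m. g k m) + (\<Sum>m. h (Suc k) m)" for k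
  proof -
    have "f (Suc k) (Suc m) = g k (Suc m) + h (Suc k) m" for m
      by (simp add: f_def g_def h_def flip: scaleR_left_distrib)
    then have "(\<Sum>m. f (Suc k) (Suc m)) = (\<Sum>m. g k (Suc m)) + (\<Sum>m. h (Suc k) m)"
      using g(1)[of k] h(1)[of "Suc k"] by (simp add: suminf_add summable_Suc_iff)
    moreover have "f (Suc k) 0 = g k 0" by (simp add: f_def g_def)
    ultimately show ?thesis
      using suminf_split_head[OF f(1)[of "Suc k"]] suminf_split_head[OF g(1)[of k]] by simp
  qed
  have "(\<Sum>k. \<Sum>m. f k m) = (\<Sum>k. (\<Sum>m. g k m) + (\<Sum>m. h (Suc k) m)) + (v 0 0 + (\<Sum>m. h 0 m))"
    using suminf_split_head[OF f(2)] by (simp add: step zero algebra_simps)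
  also have "(\<Sum>k. (\<Sum>m. g k m) + (\<Sum>m. h (Suc k) m)) = (\<Sum>k. \<Sum>m. g k m) + (\<Sum>k. \<Sum>m. h (Suc k) m)"
    using g(2) h(2) summable_Suc_iff[of "\<lambda>k. \<Sum>m. h k m"] by (intro suminf_add[symmetric]) auto
  also have "(\<Sum>k. \<Sum>m. h (Suc k) m) = (\<Sum>k. \<Sum>m. h k m) - (\<Sum>m. h 0 m)"
    by (rule suminf_split_head[OF h(2)])
  finally show ?thesis
    by (simp add: suminf2_def f_def[symmetric] g_def[symmetric] h_def[symmetric])
qed

section \<open>Growth of the Gamma function\<close>

text \<open>
  The Gamma integral restricted to \<open>[R, R + 1]\<close>. As \<open>R\<close> is arbitrary, the reciprocal of \<open>Gamma z\<close> decays
  faster than every geometric sequence.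
\<close>

lemma Gamma_lower_bound:
  fixes z R :: real
  assumes z: "1 \<le> z" and R: "1 \<le> R"
  shows "R powr (z - 1) \<le> exp (R + 1) * Gamma z"
proof -
  have I: "((\<lambda>t. t powr (z - 1) / exp t) has_integral Gamma z) {0..}"
    using Gamma_integral_real[of z] z by simp
  have "continuous_on {R..R + 1} (\<lambda>t. t powr (z - 1) / exp t)"
    using R by (intro continuous_intros) auto
  then obtain J where J: "((\<lambda>t. t powr (z - 1) / exp t) has_integral J) {R..R + 1}"
    using integrable_continuous_real unfolding integrable_on_def by blast
  have "((\<lambda>t. R powr (z - 1) / exp (R + 1)) has_integral (R + 1 - R) *\<^sub>R (R powr (z - 1) / exp (R + 1))) {R..R + 1}"
    using has_integral_const_real[of "R powr (z - 1) / exp (R + 1)" R "R + 1"] by simp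
  from has_integral_le[OF this J] have "R powr (z - 1) / exp (R + 1) \<le> J"
    using R z by (force intro!: frac_le powr_mono2)
  also have "J \<le> Gamma z"
    by (rule has_integral_subset_le[OF _ J I]) (use R in auto)
  finally show ?thesis by (simp add: field_simps)
qed

text \<open>
  With \<open>R\<close> so large that \<open>2 * M / R powr a\<close> and \<open>2 * N / R powr b\<close> are at most \<open>1/2\<close>, the bound
  \<open>(k + m) choose m \<le> 2 ^ (k + m)\<close> is absorbed by the decay of \<open>1 / Gamma\<close>.
\<close>

lemma binomial_Gamma_bound:
  fixes a b c M N :: real
  assumes a: "0 < a" and b: "0 < b" and c: "1 \<le> c" and M: "0 \<le> M" and N: "0 \<le> N"
  obtains C where "0 \<le> C"
    "\<And>k m. real ((k + m) choose m) / Gamma (real k * a + real m * b + c) * (M ^ k * N ^ m) \<le> C * (1/2) ^ k * (1/2) ^ m"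
proof -
  define R where "R = Max {1, (4 * M) powr (1 / a), (4 * N) powr (1 / b)}"
  have R: "1 \<le> R" "(4 * M) powr (1 / a) \<le> R" "(4 * N) powr (1 / b) \<le> R" by (auto simp: R_def)
  have large: "4 * M \<le> R powr a" if "0 < a" "0 \<le> M" "(4 * M) powr (1 / a) \<le> R" for M a :: real
  proof -
    have "((4 * M) powr (1 / a)) powr a \<le> R powr a"
      using that by (intro powr_mono2) auto
    then show ?thesis using that by (simp add: powr_powr)
  qed
  have ratio: "2 * M / R powr a \<le> 1 / 2" if "4 * M \<le> R powr a" for M a
  proof -
    have "0 < R powr a" using R(1) by simp
    then show ?thesis using that by (simp add: divide_le_eq)
  qed
  have MR: "2 * M / R powr a \<le> 1 / 2" and NR: "2 * N / R powr b \<le> 1 / 2"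
    by (rule ratio[OF large[OF a M R(2)]], rule ratio[OF large[OF b N R(3)]])
  show ?thesis
  proof (rule that[of "exp (R + 1)"])
    fix k m :: nat
    define z where "z = real k * a + real m * b + c"
    have z: "1 \<le> z" using a b c by (simp add: z_def add_increasing)
    have G: "0 < Gamma z" using z by (intro Gamma_real_pos) auto
    have "(R powr a) ^ k * (R powr b) ^ m = R powr (real k * a + real m * b)"
      using R(1) by (simp add: powr_add powr_powr powr_realpow[symmetric] mult.commute)
    also have "\<dots> \<le> R powr (z - 1)" using R(1) c by (intro powr_mono) (auto simp: z_def)
    also have "\<dots> \<le> exp (R + 1) * Gamma z" by (rule Gamma_lower_bound[OF z R(1)])
    finally have "1 / Gamma z \<le> exp (R + 1) / ((R powr a) ^ k * (R powr b) ^ m)"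
      using G R(1) by (simp add: field_simps)
    moreover have "real ((k + m) choose m) \<le> 2 ^ k * 2 ^ m"
    proof -
      have "(k + m) choose m \<le> 2 ^ (k + m)" by (rule binomial_le_pow2)
      then have "real ((k + m) choose m) \<le> real (2 ^ (k + m))" by (rule of_nat_mono)
      then show ?thesis by (simp add: power_add)
    qed
    ultimately have "real ((k + m) choose m) * (1 / Gamma z) \<le>
        (2 ^ k * 2 ^ m) * (exp (R + 1) / ((R powr a) ^ k * (R powr b) ^ m))"
      using G by (intro mult_mono) auto
    then have "real ((k + m) choose m) / Gamma z * (M ^ k * N ^ m) \<le>
        (2 ^ k * 2 ^ m) * (exp (R + 1) / ((R powr a) ^ k * (R powr b) ^ m)) * (M ^ k * N ^ m)"
      using M N by (intro mult_right_mono) auto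
    also have "\<dots> = exp (R + 1) * ((2 * M / R powr a) ^ k * (2 * N / R powr b) ^ m)"
      by (simp add: power_divide power_mult_distrib)
    also have "\<dots> \<le> exp (R + 1) * ((1/2) ^ k * (1/2) ^ m)"
      using M N by (intro mult_left_mono mult_mono power_mono MR NR) auto
    finally show "real ((k + m) choose m) / Gamma (real k * a + real m * b + c) * (M ^ k * N ^ m)
        \<le> exp (R + 1) * (1/2) ^ k * (1/2) ^ m"
      by (simp add: z_def mult.assoc)
  qed simp
qed

lemma binomial_Gamma_powr_bound:
  fixes a b c d M N T :: real
  assumes a: "0 < a" and b: "0 < b" and c: "1 \<le> c" and d: "0 \<le> d" and M: "0 \<le> M" and N: "0 \<le> N" and T: "0 < T"
  obtains C where "0 \<le> C"
    "\<And>k m t. 0 \<le> t \<Longrightarrow> t \<le> T \<Longrightarrow>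
       real ((k + m) choose m) * t powr (real k * a + real m * b + d) / Gamma (real k * a + real m * b + c) * (M ^ k * N ^ m)
         \<le> C * (1/2) ^ k * (1/2) ^ m"
proof -
  obtain C where C: "0 \<le> C" "\<And>k m. real ((k + m) choose m) / Gamma (real k * a + real m * b + c) *
      ((M * T powr a) ^ k * (N * T powr b) ^ m) \<le> C * (1/2) ^ k * (1/2) ^ m"
    using binomial_Gamma_bound[OF a b c, of "M * T powr a" "N * T powr b"] M N by auto
  show ?thesis
  proof (rule that[of "C * T powr d"])
    fix k m :: nat and t :: real assume t: "0 \<le> t" "t \<le> T"
    let ?e = "real k * a + real m * b + d" and ?G = "Gamma (real k * a + real m * b + c)"
    have e: "0 \<le> ?e" and G: "0 < ?G"
      using a b c d by (auto intro!: Gamma_real_pos add_nonneg_nonneg add_nonneg_pos)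
    have "t powr ?e \<le> T powr ?e" using t e by (intro powr_mono2)
    also have "\<dots> = (T powr a) ^ k * (T powr b) ^ m * T powr d"
      using T by (simp add: powr_add powr_powr powr_realpow[symmetric] mult.commute)
    finally have "real ((k + m) choose m) * t powr ?e / ?G * (M ^ k * N ^ m) \<le>
        real ((k + m) choose m) * ((T powr a) ^ k * (T powr b) ^ m * T powr d) / ?G * (M ^ k * N ^ m)"
      using G M N by (intro mult_right_mono divide_right_mono mult_left_mono) auto
    also have "\<dots> = (real ((k + m) choose m) / ?G * ((M * T powr a) ^ k * (N * T powr b) ^ m)) * T powr d"
      by (simp add: power_mult_distrib)
    also have "\<dots> \<le> (C * (1/2) ^ k * (1/2) ^ m) * T powr d" by (intro mult_right_mono C) auto
    finally show "real ((k + m) choose m) * t powr ?e / ?G * (M ^ k * N ^ m) \<le> C * T powr d * (1/2) ^ k * (1/2) ^ m"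
      by (simp add: mult_ac)
  qed (use C in auto)
qed

section \<open>Powers of bounded operators\<close>

lemma norm_blinfun_pow_le: "norm (blinfun_pow A k) \<le> norm A ^ k"
proof (induction k)
  case 0 then show ?case by (simp add: norm_blinfun_id_le)
next
  case (Suc k)
  have "norm (A o\<^sub>L blinfun_pow A k) \<le> norm A * norm (blinfun_pow A k)" by (rule norm_blinfun_compose)
  also have "\<dots> \<le> norm A * norm A ^ k" using Suc by (intro mult_left_mono) auto
  finally show ?case by simp
qed

lemma norm_blinfun_pow_pow_apply_le:
  "norm (blinfun_apply (blinfun_pow A k) (blinfun_apply (blinfun_pow B m) u)) \<le> norm A ^ k * norm B ^ m * norm u"
proof -
  have "norm (blinfun_apply (blinfun_pow A k) (blinfun_apply (blinfun_pow B m) u)) \<le>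
      norm (blinfun_pow A k) * (norm (blinfun_pow B m) * norm u)"
    by (meson norm_blinfun norm_ge_zero mult_left_mono order_trans)
  also have "\<dots> \<le> norm A ^ k * (norm B ^ m * norm u)"
    by (intro mult_mono norm_blinfun_pow_le) auto
  finally show ?thesis by (simp add: mult.assoc)
qed

lemma blinfun_pow_scaleR: "blinfun_pow (r *\<^sub>R A) k = r ^ k *\<^sub>R blinfun_pow A k"
  by (induction k) (auto intro!: blinfun_eqI simp: blinfun.scaleR_left blinfun.scaleR_right)

lemma blinfun_pow_commute:
  assumes "\<And>u. blinfun_apply A (blinfun_apply B u) = blinfun_apply B (blinfun_apply A u)"
  shows "blinfun_apply (blinfun_pow A k) (blinfun_apply B u) = blinfun_apply B (blinfun_apply (blinfun_pow A k) u)"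
  by (induction k) (auto simp: assms)

section \<open>The closed graph theorem\<close>

text \<open>
  The sets on which \<open>norm (f x) \<le> n\<close> cover the space, so by Baire's theorem the closure of one of them
  contains a ball. By symmetry and scaling every \<open>x\<close> is approximated up to half its norm by a point \<open>u x\<close>
  whose image is bounded by \<open>M * norm x\<close>. Repeating this with the error terms writes \<open>x\<close> as a series whose
  image series converges absolutely, and closedness of the graph identifies its sum with \<open>f x\<close>.
\<close>

theorem closed_graph_bounded_linear:
  fixes f :: "'a::banach \<Rightarrow> 'b::banach"
  assumes lin: "linear f"
    and clo: "\<And>X x y. X \<longlonglongrightarrow> x \<Longrightarrow> (\<lambda>n. f (X n)) \<longlonglongrightarrow> y \<Longrightarrow> f x = y"
  shows "bounded_linear f"
proof -
  interpret linear f by (rule lin)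
  define S where "S n = {x. norm (f x) \<le> real n}" for n
  have "(\<Union>n. closure (S n)) = UNIV"
  proof -
    have "x \<in> S (nat \<lceil>norm (f x)\<rceil>)" for x by (simp add: S_def real_nat_ceiling_ge)
    then show ?thesis using closure_subset by blast
  qed
  have "\<exists>n. interior (closure (S n)) \<noteq> {}"
  proof (rule ccontr)
    assume "\<nexists>n. interior (closure (S n)) \<noteq> {}"
    then have *: "interior (closure (S n)) = {}" for n by blast
    have "Met_TC.mtopology interior_of (\<Union>(range (\<lambda>n. closure (S n)))) = {}"
    proof (rule Met_TC.metric_Baire_category_alt)
      show "Met_TC.mcomplete TYPE('a)" by (simp add: complete_UNIV)
      fix T assume "T \<in> range (\<lambda>n. closure (S n))"
      then show "closedin Met_TC.mtopology T \<and> Met_TC.mtopology interior_of T = {}"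
        using * by auto
    qed auto
    then show False using \<open>(\<Union>n. closure (S n)) = UNIV\<close> by simp
  qed
  then obtain n x0 where "x0 \<in> interior (closure (S n))" by blast
  then obtain r where r: "0 < r" "ball x0 r \<subseteq> closure (S n)" by (auto simp: mem_interior)
  \<comment> \<open>Moving the ball to the origin: half the difference of approximants of
    x0 + x and x0 - x approximates x.\<close>
  have near: "\<exists>u. norm (x - u) \<le> e \<and> norm (f u) \<le> n" if x: "norm x < r" and e: "0 < e" for x e
  proof -
    have "x0 + x \<in> closure (S n)" "x0 - x \<in> closure (S n)"
      using r(2) x by (auto simp: dist_norm)
    then obtain p q where p: "p \<in> S n" "dist p (x0 + x) < e" and q: "q \<in> S n" "dist q (x0 - x) < e"
      using e unfolding closure_approachable by blast
    define u where "u = (1/2) *\<^sub>R (p - q)"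
    have "x - u = (1/2) *\<^sub>R ((x0 + x - p) - (x0 - x - q))"
      by (simp add: u_def algebra_simps flip: scaleR_add_left)
    also have "norm \<dots> \<le> (1/2) * (norm (x0 + x - p) + norm (x0 - x - q))"
      using norm_triangle_ineq4[of "x0 + x - p" "x0 - x - q"] by simp
    also have "\<dots> \<le> e" using p(2) q(2) by (simp add: dist_norm norm_minus_commute)
    finally have "norm (x - u) \<le> e" .
    moreover have "norm (f u) \<le> (1/2) * (norm (f p) + norm (f q))"
      using norm_triangle_ineq4[of "f p" "f q"] by (simp add: u_def scale diff)
    ultimately show ?thesis using p(1) q(1) by (intro exI[of _ u]) (simp add: S_def)
  qed
  define M where "M = 2 * real n / r"
  have M: "0 \<le> M" using r by (simp add: M_def)
  have half: "\<exists>u. norm (x - u) \<le> norm x / 2 \<and> norm (f u) \<le> M * norm x" for x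
  proof (cases "x = 0")
    case True then show ?thesis by (intro exI[of _ 0]) (simp add: zero)
  next
    case False
    define c where "c = r / (2 * norm x)"
    have c: "0 < c" using r False by (simp add: c_def)
    have "norm (c *\<^sub>R x) = r / 2" using c False r by (simp add: c_def)
    then obtain u where u: "norm (c *\<^sub>R x - u) \<le> r / 4" "norm (f u) \<le> n"
      using near[of "c *\<^sub>R x" "r / 4"] r by auto
    show ?thesis
    proof (intro exI[of _ "(1/c) *\<^sub>R u"] conjI)
      have "x - (1/c) *\<^sub>R u = (1/c) *\<^sub>R (c *\<^sub>R x - u)" using c by (simp add: scaleR_diff_right)
      then have "norm (x - (1/c) *\<^sub>R u) = (1/c) * norm (c *\<^sub>R x - u)"
        using c by (metis abs_of_pos norm_scaleR zero_less_divide_1_iff)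
      also have "\<dots> \<le> (1/c) * (r / 4)" using c by (intro mult_left_mono u(1)) auto
      also have "(1/c) * (r / 4) = norm x / 2" using r False by (simp add: c_def)
      finally show "norm (x - (1/c) *\<^sub>R u) \<le> norm x / 2" .
      have "norm (f ((1/c) *\<^sub>R u)) \<le> (1/c) * n" using c u(2) by (simp add: scale divide_right_mono)
      also have "\<dots> = M * norm x" using r False by (simp add: c_def M_def)
      finally show "norm (f ((1/c) *\<^sub>R u)) \<le> M * norm x" .
    qed
  qed
  then obtain u where u: "\<And>x. norm (x - u x) \<le> norm x / 2" "\<And>x. norm (f (u x)) \<le> M * norm x" by metis
  have "norm (f x) \<le> norm x * (2 * M)" for x
  proof -
    \<comment> \<open>The error that remains after j approximation steps.\<close>
    define R where "R j = ((\<lambda>x. x - u x) ^^ j) x" for j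
    have R: "norm (R j) \<le> norm x * (1/2) ^ j" for j
    proof (induction j)
      case (Suc j)
      have "norm (R (Suc j)) \<le> norm (R j) / 2" using u(1)[of "R j"] by (simp add: R_def)
      with Suc show ?case by simp
    qed (simp add: R_def)
    have sum: "(\<Sum>j<n. u (R j)) = x - R n" for n
      by (induction n) (auto simp: R_def)
    have fR: "norm (f (u (R j))) \<le> M * norm x * (1/2) ^ j" for j
      using u(2)[of "R j"] mult_left_mono[OF R[of j] M] by simp
    have g: "summable (\<lambda>j. M * norm x * (1/2::real) ^ j)"
      by (intro summable_mult summable_geometric) simp
    have s: "summable (\<lambda>j. f (u (R j)))"
      by (rule summable_comparison_test[OF _ g]) (use fR in auto)
    have "(\<lambda>n. norm x * (1/2) ^ n) \<longlonglongrightarrow> 0"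
      by (intro tendsto_mult_right_zero LIMSEQ_power_zero) simp
    then have "R \<longlonglongrightarrow> 0" by (rule Lim_null_comparison[OF always_eventually[OF allI[OF R]]])
    from tendsto_diff[OF tendsto_const[of x] this] have "(\<lambda>n. \<Sum>j<n. u (R j)) \<longlonglongrightarrow> x"
      by (simp add: sum)
    moreover have "(\<lambda>n. f (\<Sum>j<n. u (R j))) \<longlonglongrightarrow> (\<Sum>j. f (u (R j)))"
      using summable_LIMSEQ[OF s] by (simp add: Real_Vector_Spaces.linear_sum[OF lin])
    ultimately have "f x = (\<Sum>j. f (u (R j)))" by (rule clo)
    also have "norm \<dots> \<le> (\<Sum>j. M * norm x * (1/2::real) ^ j)" by (rule norm_suminf_le[OF fR g])
    also have "\<dots> = norm x * (2 * M)" by (subst suminf_mult) (auto simp: suminf_geometric)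
    finally show ?thesis .
  qed
  then show ?thesis
    by (intro bounded_linear_intro[where K="2 * M"]) (auto simp: add scale)
qed

abbreviation opow :: "('a::real_normed_vector \<Rightarrow>\<^sub>L 'a) \<Rightarrow> nat \<Rightarrow> 'a \<Rightarrow> 'a" where
  "opow A k \<equiv> blinfun_apply (blinfun_pow A k)"

text \<open>
  The operator \<open>A ^ k B ^ m\<close> applied to the fractional integral of order \<open>k a + m b\<close>. Weighted with
  \<open>(k + m) choose m\<close> these are the terms of the Neumann series for the inverse of
  \<open>1 - A J\<^sup>a - B J\<^sup>b\<close>, sorted by the numbers
  of factors of the two kinds, where \<open>J\<^sup>p\<close> is the fractional integral of order \<open>p\<close>.
\<close>

definition resolvent_term where
  "resolvent_term a b A B h t k m = opow A k (opow B m (frac_int (real k * a + real m * b) h t))"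

lemma opow_pow_bounded_linear: "bounded_linear (\<lambda>u. opow A k (opow B m u))"
  by (intro bounded_linear_compose[OF blinfun.bounded_linear_right] blinfun.bounded_linear_right)

section \<open>The resolvent of a fractional Volterra equation\<close>

lemma continuous_on_bound:
  fixes h :: "real \<Rightarrow> 'a::real_normed_vector"
  assumes "continuous_on {0..T} h"
  obtains K where "0 \<le> K" "\<And>s. s \<in> {0..T} \<Longrightarrow> norm (h s) \<le> K"
proof -
  have "bounded (h ` {0..T})" by (intro compact_imp_bounded compact_continuous_image assms) simp
  then obtain K where "0 < K" "\<forall>v\<in>h ` {0..T}. norm v \<le> K" unfolding bounded_pos by blast
  then show ?thesis using that[of K] by auto
qed

lemma resolvent_term_dominated:
  fixes h :: "real \<Rightarrow> 'a::banach"
  assumes h: "continuous_on {0..T} h" and a: "0 < a" and b: "0 < b" and t: "0 < t" "t \<le> T"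
  shows "geom_dominated (\<lambda>k m. real ((k + m) choose m) *\<^sub>R resolvent_term a b A B h t k m)"
proof -
  obtain K where K: "0 \<le> K" "\<And>s. s \<in> {0..T} \<Longrightarrow> norm (h s) \<le> K" using continuous_on_bound[OF h] by blast
  obtain C where C: "0 \<le> C" "\<And>k m r. 0 \<le> r \<Longrightarrow> r \<le> t \<Longrightarrow>
       real ((k + m) choose m) * r powr (real k * a + real m * b + 0) / Gamma (real k * a + real m * b + 1) *
        (norm A ^ k * norm B ^ m) \<le> C * (1/2) ^ k * (1/2) ^ m"
    using binomial_Gamma_powr_bound[OF a b, of 1 0 "norm A" "norm B" t] t by auto
  have "norm (real ((k + m) choose m) *\<^sub>R resolvent_term a b A B h t k m) \<le> C * K * (1/2) ^ k * (1/2) ^ m" for k m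
  proof -
    let ?p = "real k * a + real m * b"
    have p: "0 \<le> ?p" using a b by simp
    have "norm (frac_int ?p h t) \<le> K * frac_mass ?p t"
      using t by (intro norm_frac_int_le[OF h p] K) auto
    also have "frac_mass ?p t = t powr ?p / Gamma (?p + 1)" using t by (simp add: frac_mass_def)
    finally have J: "norm (frac_int ?p h t) \<le> K * (t powr ?p / Gamma (?p + 1))" .
    have "norm (real ((k + m) choose m) *\<^sub>R resolvent_term a b A B h t k m)
        \<le> real ((k + m) choose m) * (norm A ^ k * norm B ^ m * norm (frac_int ?p h t))"
      by (simp add: resolvent_term_def mult_left_mono norm_blinfun_pow_pow_apply_le)
    also have "\<dots> \<le> real ((k + m) choose m) * (norm A ^ k * norm B ^ m * (K * (t powr ?p / Gamma (?p + 1))))"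
      by (intro mult_left_mono J) auto
    also have "\<dots> = (real ((k + m) choose m) * t powr (?p + 0) / Gamma (?p + 1) * (norm A ^ k * norm B ^ m)) * K"
      by simp
    also have "\<dots> \<le> (C * (1/2) ^ k * (1/2) ^ m) * K"
      using t by (intro mult_right_mono K C(2)) auto
    finally show ?thesis by (simp add: mult_ac)
  qed
  then show ?thesis unfolding geom_dominated_def by blast
qed

definition resolvent where
  "resolvent a b A B h t = suminf2 (\<lambda>k m. real ((k + m) choose m) *\<^sub>R resolvent_term a b A B h t k m)"

lemmas resolvent_summable = geom_dominated_summable2[OF resolvent_term_dominated]

lemma resolvent_term_bounded_linear_comp:
  fixes h :: "real \<Rightarrow> 'a::banach" and L :: "'a \<Rightarrow>\<^sub>L 'a"
  assumes h: "continuous_on {0..T} h" and pos: "0 \<le> a" "0 \<le> b" "0 \<le> q" and t: "0 \<le> t" "t \<le> T"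
  shows "resolvent_term a b A B (\<lambda>s. L (frac_int q h s)) t k m =
    opow A k (opow B m (L (frac_int (real k * a + real m * b + q) h t)))"
proof -
  have p: "0 \<le> real k * a + real m * b" using pos by simp
  show ?thesis
    unfolding resolvent_term_def
      frac_int_bounded_linear[OF blinfun.bounded_linear_right continuous_on_frac_int[OF h pos(3)] p t]
      frac_int_frac_int[OF h p pos(3) t] ..
qed

lemma resolvent_add:
  fixes f g :: "real \<Rightarrow> 'a::banach"
  assumes f: "continuous_on {0..T} f" and g: "continuous_on {0..T} g"
    and a: "0 < a" and b: "0 < b" and t: "0 < t" "t \<le> T"
  shows "resolvent a b A B (\<lambda>s. f s + g s) t = resolvent a b A B f t + resolvent a b A B g t"
proof -
  have "resolvent_term a b A B (\<lambda>s. f s + g s) t k m =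
      resolvent_term a b A B f t k m + resolvent_term a b A B g t k m" for k m
    using a b t by (simp add: resolvent_term_def frac_int_add[OF f g] blinfun.add_right)
  then show ?thesis
    by (simp add: resolvent_def scaleR_right_distrib
        suminf2_add[OF resolvent_summable[OF f a b t] resolvent_summable[OF g a b t]])
qed

lemma resolvent_cong:
  assumes "\<And>s. s \<in> {0..t} \<Longrightarrow> f s = g s" "0 \<le> t"
  shows "resolvent a b A B f t = resolvent a b A B g t"
proof -
  have "frac_int p f t = frac_int p g t" for p using assms by (rule frac_int_cong)
  then show ?thesis by (simp only: resolvent_def resolvent_term_def)
qed

text \<open>
  The resolvent inverts \<open>1 - A J\<^sup>a - B J\<^sup>b\<close>: by the semigroup law and commutativity, inserting
  \<open>A J\<^sup>a\<close> or \<open>B J\<^sup>b\<close> shifts the index \<open>k\<close> or \<open>m\<close> by one, and Pascal's rule applies.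
\<close>

theorem resolvent_identity:
  fixes h :: "real \<Rightarrow> 'a::banach" and A B :: "'a \<Rightarrow>\<^sub>L 'a"
  assumes comm: "\<And>u. A (B u) = B (A u)"
    and h: "continuous_on {0..T} h" and a: "0 < a" and b: "0 < b" and t: "0 < t" "t \<le> T"
  shows "resolvent a b A B h t = h t + resolvent a b A B (\<lambda>s. A (frac_int a h s)) t
    + resolvent a b A B (\<lambda>s. B (frac_int b h s)) t"
proof -
  have cA: "continuous_on {0..T} (\<lambda>s. A (frac_int a h s))"
    and cB: "continuous_on {0..T} (\<lambda>s. B (frac_int b h s))"
    using a b h by (auto intro!: continuous_intros continuous_on_frac_int)
  have pos: "0 \<le> a" "0 \<le> b" "0 \<le> t" using a b t by auto
  have A: "resolvent_term a b A B (\<lambda>s. A (frac_int a h s)) t k m = resolvent_term a b A B h t (Suc k) m" for k m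
  proof -
    have "opow B m (A u) = A (opow B m u)" for u using blinfun_pow_commute[of B A] comm by metis
    moreover have "opow A k (A u) = opow A (Suc k) u" for u using blinfun_pow_commute[of A A k u] by simp
    ultimately have "opow A k (opow B m (A u)) = opow A (Suc k) (opow B m u)" for u by simp
    moreover have "real k * a + real m * b + a = real (Suc k) * a + real m * b" by (simp add: algebra_simps)
    ultimately show ?thesis
      unfolding resolvent_term_bounded_linear_comp[OF h pos(1,2,1,3) t(2)] by (simp only: resolvent_term_def)
  qed
  have B: "resolvent_term a b A B (\<lambda>s. B (frac_int b h s)) t k m = resolvent_term a b A B h t k (Suc m)" for k m
  proof -
    have "opow B m (B u) = opow B (Suc m) u" for u using blinfun_pow_commute[of B B m u] by simp
    moreover have "real k * a + real m * b + b = real k * a + real (Suc m) * b" by (simp add: algebra_simps)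
    ultimately show ?thesis
      unfolding resolvent_term_bounded_linear_comp[OF h pos(1,2,2,3) t(2)] by (simp only: resolvent_term_def)
  qed
  have "resolvent_term a b A B h t 0 0 = h t" by (simp add: resolvent_term_def)
  then show ?thesis
    using suminf2_pascal[OF resolvent_summable[OF h a b t, of A B]
        resolvent_summable[OF cA a b t, of A B, unfolded A] resolvent_summable[OF cB a b t, of A B, unfolded B]]
    by (simp add: resolvent_def A B)
qed

text \<open>
  Applying the resolvent to both sides of the equation cancels every occurrence of \<open>x\<close> but one. In
  particular the solution is unique, without an iteration argument.
\<close>

theorem volterra_solution:
  fixes x f :: "real \<Rightarrow> 'a::banach" and A B :: "'a \<Rightarrow>\<^sub>L 'a"
  assumes comm: "\<And>u. A (B u) = B (A u)" and x: "continuous_on {0..T} x" and f: "continuous_on {0..T} f"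
    and a: "0 < a" and b: "0 < b" and t: "0 < t" "t \<le> T"
    and eq: "\<And>s. s \<in> {0..T} \<Longrightarrow> x s = f s + A (frac_int a x s) + B (frac_int b x s)"
  shows "x t = resolvent a b A B f t"
proof -
  have cA: "continuous_on {0..T} (\<lambda>s. A (frac_int a x s))"
    and cB: "continuous_on {0..T} (\<lambda>s. B (frac_int b x s))"
    using a b x by (auto intro!: continuous_intros continuous_on_frac_int)
  have "resolvent a b A B x t = resolvent a b A B (\<lambda>s. f s + A (frac_int a x s) + B (frac_int b x s)) t"
    using t eq by (intro resolvent_cong) auto
  also have "\<dots> = resolvent a b A B f t + resolvent a b A B (\<lambda>s. A (frac_int a x s)) t
      + resolvent a b A B (\<lambda>s. B (frac_int b x s)) t"
    by (simp add: resolvent_add[OF continuous_on_add[OF f cA] cB a b t] resolvent_add[OF f cA a b t])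
  finally show ?thesis using resolvent_identity[OF comm x a b t] by simp
qed

text \<open>
  The inhomogeneity contains \<open>\<eta> - A J\<^sup>a \<eta>\<close>. Since the resolvent inverts \<open>1 - A J\<^sup>a - B J\<^sup>b\<close>, it maps
  this part to \<open>\<eta>\<close> plus the resolvent of \<open>B J\<^sup>b \<eta>\<close>, which explains why \<open>\<eta>\<close> occurs in the solution
  formula with an additional factor \<open>B\<close>.
\<close>

theorem volterra_solution_initial_data:
  fixes x g :: "real \<Rightarrow> 'a::banach" and A B :: "'a \<Rightarrow>\<^sub>L 'a"
  assumes comm: "\<And>u. A (B u) = B (A u)" and x: "continuous_on {0..T} x" and g: "continuous_on {0..T} g"
    and a: "0 < a" and b: "0 < b" and t: "0 < t" "t \<le> T"
    and eq: "\<And>s. s \<in> {0..T} \<Longrightarrow> x s - \<eta> - s *\<^sub>R \<eta>' =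
      A (frac_int a x s) - A (frac_int a (\<lambda>_. \<eta>) s) + B (frac_int b x s) + frac_int b g s"
  shows "x t = \<eta> + resolvent a b A B (\<lambda>s. B (frac_int b (\<lambda>_. \<eta>) s)) t
    + resolvent a b A B (\<lambda>s. s *\<^sub>R \<eta>') t + resolvent a b A B (frac_int b g) t"
proof -
  have c\<eta>: "continuous_on {0..T} (\<lambda>_. \<eta>)" and c': "continuous_on {0..T} (\<lambda>s. s *\<^sub>R \<eta>')"
    by (auto intro!: continuous_intros)
  have cA: "continuous_on {0..T} (\<lambda>s. A (frac_int a (\<lambda>_. \<eta>) s))"
    and cB: "continuous_on {0..T} (\<lambda>s. B (frac_int b (\<lambda>_. \<eta>) s))"
    and cg: "continuous_on {0..T} (frac_int b g)"
    using a b g c\<eta> by (auto intro!: continuous_intros continuous_on_frac_int)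
  define f where "f s = \<eta> + s *\<^sub>R \<eta>' - A (frac_int a (\<lambda>_. \<eta>) s) + frac_int b g s" for s
  have cf: "continuous_on {0..T} f" unfolding f_def by (intro continuous_intros cA cg)
  have xf: "x t = resolvent a b A B f t"
  proof (rule volterra_solution[OF comm x cf a b t])
    fix s assume "s \<in> {0..T}"
    from eq[OF this] show "x s = f s + A (frac_int a x s) + B (frac_int b x s)"
      by (simp add: f_def algebra_simps)
  qed
  have "resolvent a b A B f t + resolvent a b A B (\<lambda>s. A (frac_int a (\<lambda>_. \<eta>) s)) t
      = resolvent a b A B (\<lambda>s. f s + A (frac_int a (\<lambda>_. \<eta>) s)) t"
    by (rule resolvent_add[OF cf cA a b t, symmetric])
  also have "\<dots> = resolvent a b A B (\<lambda>s. (\<eta> + s *\<^sub>R \<eta>') + frac_int b g s) t"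
    by (simp add: f_def)
  also have "\<dots> = resolvent a b A B (\<lambda>_. \<eta>) t + resolvent a b A B (\<lambda>s. s *\<^sub>R \<eta>') t + resolvent a b A B (frac_int b g) t"
    by (simp add: resolvent_add[OF continuous_on_add[OF c\<eta> c'] cg a b t] resolvent_add[OF c\<eta> c' a b t])
  finally show ?thesis
    using xf resolvent_identity[OF comm c\<eta> a b t] by (simp add: algebra_simps)
qed

section \<open>From the Caputo equation to the Volterra equation\<close>

text \<open>
  The differential equation is only required for \<open>t > 0\<close>; by continuity it holds at \<open>0\<close> as well.
\<close>

lemma continuous_on_zero_extends:
  fixes D :: "real \<Rightarrow> 'a::real_normed_vector"
  assumes c: "continuous_on {0..T} D" and D: "\<And>s. s \<in> {0<..T} \<Longrightarrow> D s = 0" and T: "0 < T" and s: "s \<in> {0..T}"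
  shows "D s = 0"
proof -
  have cl: "closure {0<..T} = {0..T}" using T by simp
  show ?thesis
    by (rule continuous_constant_on_closure[of "{0<..T}" D 0 s]) (use c D s T in \<open>simp_all only: cl\<close>)
qed

text \<open>
  Applying the fractional integral of order \<open>\<alpha>\<close>: the term with \<open>x''\<close> becomes \<open>J\<^sup>2 x''\<close> by the
  semigroup law, hence \<open>x t - x 0 - t x' 0\<close>, and the term with \<open>x'\<close> becomes \<open>J\<^sup>1\<^sup>+\<^sup>\<alpha>\<^sup>-\<^sup>\<beta> x'\<close>, hence
  \<open>J\<^sup>\<alpha>\<^sup>-\<^sup>\<beta> (x - x 0)\<close>.
\<close>

theorem fractional_cauchy_volterra:
  fixes x x' x'' g :: "real \<Rightarrow> 'a::banach" and A B :: "'a \<Rightarrow>\<^sub>L 'a"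
  assumes x': "\<And>s. s \<in> {0..T} \<Longrightarrow> (x has_vector_derivative x' s) (at s within {0..T})"
    and x'': "\<And>s. s \<in> {0..T} \<Longrightarrow> (x' has_vector_derivative x'' s) (at s within {0..T})"
    and c'': "continuous_on {0..T} x''" and g: "continuous_on {0..T} g"
    and T: "0 < T" and \<alpha>: "1 < \<alpha>" "\<alpha> \<le> 2" and \<beta>: "0 < \<beta>" "\<beta> \<le> 1"
    and eq: "\<And>s. s \<in> {0<..T} \<Longrightarrow> frac_int (2 - \<alpha>) x'' s - A (frac_int (1 - \<beta>) x' s) = B (x s) + g s"
    and t: "t \<in> {0..T}"
  shows "x t - x 0 - t *\<^sub>R x' 0 = A (frac_int (\<alpha> - \<beta>) x t) - A (frac_int (\<alpha> - \<beta>) (\<lambda>_. x 0) t)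
    + B (frac_int \<alpha> x t) + frac_int \<alpha> g t"
proof -
  have c': "continuous_on {0..T} x'" and c: "continuous_on {0..T} x"
    by (rule continuous_on_vector_derivative, erule x'') (rule continuous_on_vector_derivative, erule x')
  have t': "0 \<le> t" "t \<le> T" using t by auto
  define p where "p s = A (frac_int (1 - \<beta>) x' s)" for s
  define q where "q s = B (x s)" for s
  have cp: "continuous_on {0..T} p" and cq: "continuous_on {0..T} q"
    unfolding p_def q_def using \<beta> c c' by (auto intro!: continuous_intros continuous_on_frac_int)
  have cl: "continuous_on {0..T} (frac_int (2 - \<alpha>) x'')"
    using \<alpha> c'' by (intro continuous_on_frac_int) auto
  have eq0: "frac_int (2 - \<alpha>) x'' s = p s + q s + g s" if "s \<in> {0..T}" for s
  proof -
    have "frac_int (2 - \<alpha>) x'' s - (p s + q s + g s) = 0"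
    proof (rule continuous_on_zero_extends[OF _ _ T that])
      show "continuous_on {0..T} (\<lambda>s. frac_int (2 - \<alpha>) x'' s - (p s + q s + g s))"
        by (intro continuous_intros cl cp cq g)
      fix s assume "s \<in> {0<..T}"
      from eq[OF this] show "frac_int (2 - \<alpha>) x'' s - (p s + q s + g s) = 0"
        by (simp add: p_def q_def algebra_simps)
    qed
    then show ?thesis by simp
  qed
  have J1x': "frac_int 1 x' s = x s - x 0" and J1x'': "frac_int 1 x'' s = x' s - x' 0" if "s \<in> {0..T}" for s
    using that by (auto intro!: frac_int_1_derivative[OF x' c'] frac_int_1_derivative[OF x'' c''])
  have \<alpha>0: "0 \<le> \<alpha>" and a0: "0 \<le> \<alpha> - \<beta>" using \<alpha> \<beta> by auto
  have "frac_int \<alpha> (frac_int (2 - \<alpha>) x'') t = frac_int 2 x'' t"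
    using \<alpha> frac_int_frac_int[OF c'' _ _ t', of \<alpha> "2 - \<alpha>"] by simp
  also have "\<dots> = frac_int 1 (frac_int 1 x'') t"
    using frac_int_frac_int[OF c'' _ _ t', of 1 1] by simp
  also have "\<dots> = frac_int 1 (\<lambda>s. x' s - x' 0) t"
    using t' J1x'' by (intro frac_int_cong) auto
  also have "\<dots> = frac_int 1 x' t - frac_int 1 (\<lambda>s. x' 0) t"
    using t' by (intro frac_int_diff[OF c']) auto
  also have "\<dots> = x t - x 0 - t *\<^sub>R x' 0"
    using frac_int_monomial[of 1 t 0 "x' 0"] t' J1x'[OF t] by (simp add: Gamma_fact[of 1, simplified])
  finally have L: "frac_int \<alpha> (frac_int (2 - \<alpha>) x'') t = x t - x 0 - t *\<^sub>R x' 0" .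
  have "frac_int \<alpha> (frac_int (2 - \<alpha>) x'') t = frac_int \<alpha> (\<lambda>s. p s + q s + g s) t"
    using t' eq0 by (intro frac_int_cong) auto
  also have "\<dots> = frac_int \<alpha> p t + frac_int \<alpha> q t + frac_int \<alpha> g t"
    by (simp add: frac_int_add[OF continuous_on_add[OF cp cq] g \<alpha>0 t'] frac_int_add[OF cp cq \<alpha>0 t'])
  also have "frac_int \<alpha> q t = B (frac_int \<alpha> x t)"
    unfolding q_def by (rule frac_int_bounded_linear[OF blinfun.bounded_linear_right c \<alpha>0 t'])
  also have "frac_int \<alpha> p t = A (frac_int \<alpha> (frac_int (1 - \<beta>) x') t)"
    unfolding p_def using \<beta>
    by (intro frac_int_bounded_linear[OF blinfun.bounded_linear_right _ \<alpha>0 t'] continuous_on_frac_int c') auto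
  also have "frac_int \<alpha> (frac_int (1 - \<beta>) x') t = frac_int (\<alpha> - \<beta>) (frac_int 1 x') t"
    using frac_int_frac_int[OF c' \<alpha>0 _ t', of "1 - \<beta>"] frac_int_frac_int[OF c' a0 _ t', of 1] \<beta>
    by (simp add: algebra_simps)
  also have "\<dots> = frac_int (\<alpha> - \<beta>) (\<lambda>s. x s - x 0) t"
    using t' J1x' by (intro frac_int_cong) auto
  also have "\<dots> = frac_int (\<alpha> - \<beta>) x t - frac_int (\<alpha> - \<beta>) (\<lambda>_. x 0) t"
    by (intro frac_int_diff[OF c _ a0 t']) auto
  finally show ?thesis unfolding L by (simp add: blinfun.diff_right)
qed

section \<open>Mittag-Leffler representation of the resolvent\<close>

lemma mittag_leffler_term_dominated:
  fixes P Q :: "'a::real_normed_vector \<Rightarrow>\<^sub>L 'a"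
  assumes a: "0 < a" and b: "0 < b" and c: "1 \<le> c"
  shows "geom_dominated (mittag_leffler_term a b c P Q)"
proof -
  obtain C where C: "0 \<le> C" "\<And>k m. real ((k + m) choose m) / Gamma (real k * a + real m * b + c) *
      (norm P ^ k * norm Q ^ m) \<le> C * (1/2) ^ k * (1/2) ^ m"
    using binomial_Gamma_bound[OF a b c, of "norm P" "norm Q"] by auto
  have "norm (mittag_leffler_term a b c P Q k m) \<le> C * (1/2) ^ k * (1/2) ^ m" for k m
  proof -
    have G: "0 < Gamma (real k * a + real m * b + c)"
      using a b c by (auto intro!: Gamma_real_pos add_nonneg_pos)
    have "norm (blinfun_pow P k o\<^sub>L blinfun_pow Q m) \<le> norm (blinfun_pow P k) * norm (blinfun_pow Q m)"
      by (rule norm_blinfun_compose)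
    also have "\<dots> \<le> norm P ^ k * norm Q ^ m" by (intro mult_mono norm_blinfun_pow_le) auto
    finally have "real ((k + m) choose m) / Gamma (real k * a + real m * b + c) *
        norm (blinfun_pow P k o\<^sub>L blinfun_pow Q m) \<le>
        real ((k + m) choose m) / Gamma (real k * a + real m * b + c) * (norm P ^ k * norm Q ^ m)"
      using G by (intro mult_left_mono) auto
    also have "\<dots> \<le> C * (1/2) ^ k * (1/2) ^ m" by (rule C(2))
    finally show ?thesis using G by (simp add: mittag_leffler_term_def)
  qed
  then show ?thesis unfolding geom_dominated_def by blast
qed

lemmas mittag_leffler_summable2 = geom_dominated_summable2[OF mittag_leffler_term_dominated]

text \<open>
  The general term of \<open>r powr d\<close> times the Mittag-Leffler function at \<open>r\<close>. With the factor
  \<open>r powr d\<close>, \<open>d > 0\<close>, included, the powers of \<open>r\<close> combine correctly also at \<open>r = 0\<close>, where both sides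
  vanish; this point occurs as the end point of the convolution integral.
\<close>

definition scaled_term where
  "scaled_term a b c d A B r k m =
     (real ((k + m) choose m) * r powr (real k * a + real m * b + d) / Gamma (real k * a + real m * b + c)) *\<^sub>R
       (blinfun_pow A k o\<^sub>L blinfun_pow B m)"

lemma scaled_term_eq:
  assumes "0 \<le> r" "0 < a" "0 < b" "0 < d"
  shows "scaled_term a b c d A B r k m =
    r powr d *\<^sub>R mittag_leffler_term a b c (r powr a *\<^sub>R A) (r powr b *\<^sub>R B) k m"
proof (cases "r = 0")
  case True then show ?thesis using assms by (simp add: scaled_term_def)
next
  case False
  then have r: "0 < r" using assms by simp
  have "r powr (real k * a + real m * b + d) = r powr d * (r powr a) ^ k * (r powr b) ^ m"
    using r by (simp add: powr_add powr_powr powr_realpow[symmetric] mult.commute)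
  moreover have "blinfun_pow (r powr a *\<^sub>R A) k o\<^sub>L blinfun_pow (r powr b *\<^sub>R B) m =
      ((r powr a) ^ k * (r powr b) ^ m) *\<^sub>R (blinfun_pow A k o\<^sub>L blinfun_pow B m)"
    by (rule blinfun_eqI) (simp add: blinfun_pow_scaleR blinfun.scaleR_left blinfun.scaleR_right)
  ultimately show ?thesis
    by (simp add: scaled_term_def mittag_leffler_term_def mult_ac)
qed

lemma scaled_mittag_leffler:
  fixes A B :: "'a::banach \<Rightarrow>\<^sub>L 'a"
  assumes r: "0 \<le> r" and a: "0 < a" and b: "0 < b" and d: "0 < d" and c: "1 \<le> c"
  shows "summable2 (scaled_term a b c d A B r)"
    "suminf2 (scaled_term a b c d A B r) =
      r powr d *\<^sub>R mittag_leffler a b c (r powr a *\<^sub>R A) (r powr b *\<^sub>R B)"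
  using summable2_bounded_linear[OF bounded_linear_scaleR_right mittag_leffler_summable2[OF a b c],
      of "r powr d" "r powr a *\<^sub>R A" "r powr b *\<^sub>R B"]
  by (simp_all add: scaled_term_eq[OF r a b d, abs_def] mittag_leffler_def)

lemma apply_scaled_mittag_leffler:
  fixes A B :: "'a::banach \<Rightarrow>\<^sub>L 'a"
  assumes r: "0 \<le> r" and a: "0 < a" and b: "0 < b" and d: "0 < d" and c: "1 \<le> c" and L: "bounded_linear L"
  shows "summable2 (\<lambda>k m. L (scaled_term a b c d A B r k m))"
    "suminf2 (\<lambda>k m. L (scaled_term a b c d A B r k m)) =
      L (r powr d *\<^sub>R mittag_leffler a b c (r powr a *\<^sub>R A) (r powr b *\<^sub>R B))"
  by (rule summable2_bounded_linear(1)[OF L scaled_mittag_leffler(1)[OF r a b d c]],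
      simp only: summable2_bounded_linear(2)[OF L scaled_mittag_leffler(1)[OF r a b d c]]
        scaled_mittag_leffler(2)[OF r a b d c])

text \<open>
  The fractional integral of a constant is a power of \<open>t\<close> divided by a Gamma value, so the resolvent of
  \<open>B J\<^sup>b \<eta>\<close> is a Mittag-Leffler series term by term.
\<close>

lemma resolvent_initial_value:
  fixes A B :: "'a::banach \<Rightarrow>\<^sub>L 'a"
  assumes comm: "\<And>u. A (B u) = B (A u)" and a: "0 < a" and b: "0 < b" and t: "0 < t" "t \<le> T"
  shows "resolvent a b A B (\<lambda>s. B (frac_int b (\<lambda>_. \<eta>) s)) t =
    B ((t powr b *\<^sub>R mittag_leffler a b (b + 1) (t powr a *\<^sub>R A) (t powr b *\<^sub>R B)) \<eta>)"
proof -
  have "real ((k + m) choose m) *\<^sub>R resolvent_term a b A B (\<lambda>s. B (frac_int b (\<lambda>_. \<eta>) s)) t k m =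
      B (scaled_term a b (b + 1) b A B t k m \<eta>)" for k m
  proof -
    let ?p = "real k * a + real m * b + b"
    have p: "0 < ?p" using a b by (simp add: add_nonneg_pos)
    have "frac_int ?p (\<lambda>_. \<eta>) t = (t powr ?p / Gamma (?p + 1)) *\<^sub>R \<eta>"
      using frac_int_monomial[OF p, of t 0 \<eta>] t by simp
    moreover have "opow B m (B u) = B (opow B m u)" "opow A k (B u) = B (opow A k u)" for u
      using blinfun_pow_commute[of B B m] blinfun_pow_commute[of A B k] comm by auto
    ultimately show ?thesis
      using resolvent_term_bounded_linear_comp[of T "\<lambda>_. \<eta>" a b b t A B B k m] a b t
      by (simp add: scaled_term_def blinfun.scaleR_left blinfun.scaleR_right algebra_simps)
  qed
  then show ?thesis
    unfolding resolvent_def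
    using apply_scaled_mittag_leffler(2)[of t a b b "b + 1" "\<lambda>X. B (blinfun_apply X \<eta>)" A B] a b t
    by (simp add: bounded_linear_compose[OF blinfun.bounded_linear_right blinfun.bounded_linear_left])
qed

lemma resolvent_initial_slope:
  fixes A B :: "'a::banach \<Rightarrow>\<^sub>L 'a"
  assumes a: "0 < a" and b: "0 < b" and t: "0 < t"
  shows "resolvent a b A B (\<lambda>s. s *\<^sub>R \<eta>') t =
    (t *\<^sub>R mittag_leffler a b 2 (t powr a *\<^sub>R A) (t powr b *\<^sub>R B)) \<eta>'"
proof -
  have "real ((k + m) choose m) *\<^sub>R resolvent_term a b A B (\<lambda>s. s *\<^sub>R \<eta>') t k m =
      scaled_term a b 2 1 A B t k m \<eta>'" for k m
  proof -
    let ?p = "real k * a + real m * b"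
    have "frac_int ?p (\<lambda>s. s *\<^sub>R \<eta>') t = (t powr (?p + 1) / Gamma (?p + 2)) *\<^sub>R \<eta>'"
    proof (cases "?p = 0")
      case True then show ?thesis using t Gamma_fact[of 1, where ?'a=real] by (simp add: frac_int_def)
    next
      case False
      then have "0 < ?p" using a b by (simp add: less_le)
      from frac_int_monomial[OF this, of t 1 \<eta>'] t show ?thesis by (simp add: algebra_simps)
    qed
    then show ?thesis
      by (simp add: resolvent_term_def scaled_term_def blinfun.scaleR_left blinfun.scaleR_right)
  qed
  then show ?thesis
    unfolding resolvent_def
    using apply_scaled_mittag_leffler(2)[of t a b 1 2 "\<lambda>X. blinfun_apply X \<eta>'" A B] a b t
    by (simp add: blinfun.bounded_linear_left)
qed

text \<open>
  Continuity of the summands on the half-open interval makes the partial sums measurable.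
\<close>

lemma has_bochner_sum:
  fixes f :: "'i \<Rightarrow> real \<Rightarrow> 'b::real_normed_vector"
  assumes "finite K" "\<And>i. i \<in> K \<Longrightarrow> has_bochner (lebesgue_on {0..t}) (f i) (I i)"
    and c: "\<And>i. i \<in> K \<Longrightarrow> continuous_on {0..<t} (f i)"
  shows "has_bochner (lebesgue_on {0..t}) (\<lambda>s. \<Sum>i\<in>K. f i s) (\<Sum>i\<in>K. I i)"
  using assms
proof (induction K)
  case empty
  have "has_bochner (lebesgue_on {0..t}) (\<lambda>s. (0::real) *\<^sub>R (0::'b)) ((0::real) *\<^sub>R 0)"
    by (rule has_bochner_real_scaleR) auto
  then show ?case by simp
next
  case (insert i K)
  have "has_bochner (lebesgue_on {0..t}) (\<lambda>s. f i s + (\<Sum>i\<in>K. f i s)) (I i + (\<Sum>i\<in>K. I i))"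
    by (intro has_bochner_add insert borel_measurable_continuous_on_ivl_open continuous_intros) auto
  then show ?case using insert.hyps by simp
qed

text \<open>
  The resolvent of \<open>J\<^sup>b g\<close> is the convolution of \<open>g\<close> with a Mittag-Leffler kernel. Each term of the
  resolvent is an integral with a power kernel, and the partial sums of the kernel series converge uniformly
  on \<open>[0, t]\<close>, so summation and integration may be interchanged. The hypothesis \<open>1 < b\<close> makes the kernel
  bounded.
\<close>

theorem has_bochner_resolvent:
  fixes A B :: "'a::banach \<Rightarrow>\<^sub>L 'a"
  assumes g: "continuous_on {0..T} g" and a: "0 < a" and b: "1 < b" and t: "0 < t" "t \<le> T"
  shows "has_bochner (lebesgue_on {0..t})
    (\<lambda>s. ((t - s) powr (b - 1) *\<^sub>R
      mittag_leffler a b b ((t - s) powr a *\<^sub>R A) ((t - s) powr b *\<^sub>R B)) (g s))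
    (resolvent a b A B (frac_int b g) t)"
proof -
  let ?M = "lebesgue_on {0..t}"
  define f where "f s = ((t - s) powr (b - 1) *\<^sub>R
      mittag_leffler a b b ((t - s) powr a *\<^sub>R A) ((t - s) powr b *\<^sub>R B)) (g s)" for s
  define S where "S s k m = scaled_term a b b (b - 1) A B (t - s) k m (g s)" for s k m
  define I where "I k m = real ((k + m) choose m) *\<^sub>R resolvent_term a b A B (frac_int b g) t k m" for k m
  have b0: "0 < b" "0 \<le> b" using b by auto
  have fS: "f s = suminf2 (S s)" if "s \<in> {0..t}" for s
    unfolding f_def S_def
    using apply_scaled_mittag_leffler(2)[of "t - s" a b "b - 1" b "\<lambda>X. blinfun_apply X (g s)" A B] that a b
    by (simp add: blinfun.bounded_linear_left)
  have hb: "has_bochner ?M (\<lambda>s. S s k m) (I k m)" and cont: "continuous_on {0..<t} (\<lambda>s. S s k m)" for k m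
  proof -
    let ?p = "real k * a + real m * b"
    have p: "0 \<le> ?p" "0 < ?p + b" using a b by (auto simp: add_nonneg_pos)
    have S: "S s k m = (real ((k + m) choose m) / Gamma (?p + b)) *\<^sub>R
        opow A k (opow B m ((t - s) powr (?p + b - 1) *\<^sub>R g s))" for s
      by (simp add: S_def scaled_term_def blinfun.scaleR_left blinfun.scaleR_right add_diff_eq)
    have lin: "bounded_linear (\<lambda>u. (real ((k + m) choose m) / Gamma (?p + b)) *\<^sub>R opow A k (opow B m u))"
      by (rule bounded_linear_compose[OF bounded_linear_scaleR_right opow_pow_bounded_linear])
    have "(real ((k + m) choose m) / Gamma (?p + b)) *\<^sub>R opow A k (opow B m (Gamma (?p + b) *\<^sub>R frac_int (?p + b) g t)) = I k m"
      using Gamma_pos_nonzero[OF p(2)] frac_int_frac_int[OF g p(1) b0(2), of t] t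
      by (simp add: I_def resolvent_term_def blinfun.scaleR_right)
    with has_bochner_bounded_linear[OF lin has_bochner_frac_int[OF g p(2), of t]] t
    show "has_bochner ?M (\<lambda>s. S s k m) (I k m)" by (simp add: S)
    have "continuous_on {0..<t} (\<lambda>s. (t - s) powr (?p + b - 1) *\<^sub>R g s)"
      by (intro continuous_on_scaleR continuous_on_kernel continuous_on_subset[OF g]) (use t in auto)
    from bounded_linear.continuous_on[OF lin this] show "continuous_on {0..<t} (\<lambda>s. S s k m)"
      by (simp only: S)
  qed
  obtain K where K: "0 \<le> K" "\<And>s. s \<in> {0..T} \<Longrightarrow> norm (g s) \<le> K" using continuous_on_bound[OF g] by blast
  obtain C where C: "0 \<le> C" "\<And>k m r. 0 \<le> r \<Longrightarrow> r \<le> t \<Longrightarrow>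
       real ((k + m) choose m) * r powr (real k * a + real m * b + (b - 1)) / Gamma (real k * a + real m * b + b) *
        (norm A ^ k * norm B ^ m) \<le> C * (1/2) ^ k * (1/2) ^ m"
    using binomial_Gamma_powr_bound[OF a b0(1), of b "b - 1" "norm A" "norm B" t] t b by auto
  have dom: "norm (S s k m) \<le> C * K * (1/2) ^ k * (1/2) ^ m" if s: "s \<in> {0..t}" for s k m
  proof -
    let ?c = "real ((k + m) choose m) * (t - s) powr (real k * a + real m * b + (b - 1)) / Gamma (real k * a + real m * b + b)"
    have G: "0 < Gamma (real k * a + real m * b + b)"
      using a b by (auto intro!: Gamma_real_pos add_nonneg_pos)
    then have c: "0 \<le> ?c" by simp
    have "norm (S s k m) = ?c * norm (opow A k (opow B m (g s)))"
      by (simp add: S_def scaled_term_def blinfun.scaleR_left abs_of_pos[OF G])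
    also have "\<dots> \<le> ?c * (norm A ^ k * norm B ^ m * K)"
      using s t by (intro mult_left_mono[OF order_trans[OF norm_blinfun_pow_pow_apply_le]] mult_left_mono K c) auto
    also have "\<dots> = (?c * (norm A ^ k * norm B ^ m)) * K" by simp
    also have "\<dots> \<le> (C * (1/2) ^ k * (1/2) ^ m) * K"
      using s t by (intro mult_right_mono K C(2)) auto
    finally show ?thesis by (simp add: mult_ac)
  qed
  \<comment> \<open>Square partial sums of the integrand converge uniformly by the truncation estimate.\<close>
  define F where "F N s = (\<Sum>k<N. \<Sum>m<N. S s k m)" for N s
  have F: "has_bochner ?M (F N) (\<Sum>k<N. \<Sum>m<N. I k m)" for N
    unfolding F_def by (intro has_bochner_sum hb continuous_intros cont) auto
  have near: "norm (f s - F N s) \<le> 8 * (C * K) * (1/2) ^ N" if "s \<in> {0..t}" for s N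
    unfolding fS[OF that] F_def by (rule suminf2_truncation[OF dom[OF that]])
  have lim0: "(\<lambda>N. 8 * (C * K) * (1/2::real) ^ N) \<longlonglongrightarrow> 0"
    by (intro tendsto_mult_right_zero LIMSEQ_power_zero) simp
  have meas: "f \<in> borel_measurable ?M"
  proof (rule borel_measurable_LIMSEQ_metric)
    show "F N \<in> borel_measurable ?M" for N using F[of N] by (simp add: has_bochner_def)
    fix s assume "s \<in> space ?M"
    then have "norm (f s - F N s) \<le> 8 * (C * K) * (1/2) ^ N" for N using near by simp
    then have "(\<lambda>N. f s - F N s) \<longlonglongrightarrow> 0" by (intro Lim_null_comparison[OF always_eventually lim0]) auto
    from tendsto_diff[OF tendsto_const[of "f s"] this] show "(\<lambda>N. F N s) \<longlonglongrightarrow> f s" by simp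
  qed
  have "\<exists>J. (\<lambda>N. \<Sum>k<N. \<Sum>m<N. I k m) \<longlonglongrightarrow> J \<and> has_bochner ?M f J"
  proof (rule has_bochner_limit[OF meas F, where w="\<lambda>_. 1" and W=t])
    show "(\<integral>\<^sup>+ x. ennreal 1 \<partial>?M) = ennreal t"
      using t by (simp add: emeasure_restrict_space)
    show "norm (f s - F N s) \<le> 8 * (C * K) * (1/2) ^ N * 1" if "s \<in> space ?M" for s N
      using near that by simp
  qed (use lim0 C K in auto)
  then obtain J where J: "(\<lambda>N. \<Sum>k<N. \<Sum>m<N. I k m) \<longlonglongrightarrow> J" "has_bochner ?M f J" by blast
  have cg: "continuous_on {0..T} (frac_int b g)" by (rule continuous_on_frac_int[OF g b0(2)])
  \<comment> \<open>The integrals of the partial sums are the partial sums of the resolvent series.\<close>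
  obtain D where D: "\<And>k m. norm (I k m) \<le> D * (1/2) ^ k * (1/2) ^ m"
    using resolvent_term_dominated[OF cg a b0(1) t, of A B] by (auto simp: geom_dominated_def I_def)
  have "(\<lambda>N. suminf2 I - (\<Sum>k<N. \<Sum>m<N. I k m)) \<longlonglongrightarrow> 0"
  proof (rule Lim_null_comparison[OF always_eventually])
    show "\<forall>N. norm (suminf2 I - (\<Sum>k<N. \<Sum>m<N. I k m)) \<le> 8 * D * (1/2) ^ N"
      using suminf2_truncation[OF D] by blast
    show "(\<lambda>N. 8 * D * (1/2::real) ^ N) \<longlonglongrightarrow> 0"
      by (intro tendsto_mult_right_zero LIMSEQ_power_zero) simp
  qed
  from tendsto_diff[OF tendsto_const[of "suminf2 I"] this]
  have "(\<lambda>N. \<Sum>k<N. \<Sum>m<N. I k m) \<longlonglongrightarrow> suminf2 I" by simp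
  then have "J = suminf2 I" using J(1) LIMSEQ_unique by blast
  then show ?thesis using J(2) by (simp add: resolvent_def I_def[abs_def] f_def[abs_def])
qed

section \<open>Caputo derivatives and the operators of the Cauchy problem\<close>

text \<open>
  The exceptional case in the definition of the Caputo derivative is exactly the order \<open>0\<close> of the fractional
  integral.
\<close>

lemma caputo_eq_frac_int:
  "caputo T \<nu> x t = frac_int (real (nat \<lceil>\<nu>\<rceil>) - \<nu>) (vderiv_on {0..T} (nat \<lceil>\<nu>\<rceil>) x) t"
  by (auto simp: caputo_def frac_int_def Let_def)

lemma Ck_on_2_has_vector_derivative:
  assumes "Ck_on 2 J x" "s \<in> J"
  shows "(x has_vector_derivative vderiv_on J 1 x s) (at s within J)"
    "(vderiv_on J 1 x has_vector_derivative vderiv_on J 2 x s) (at s within J)"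
proof -
  have "vderiv_on J 0 x differentiable_on J" "vderiv_on J 1 x differentiable_on J"
    using assms(1) unfolding Ck_on_def by (auto simp only: one_less_numeral_iff zero_less_numeral semiring_norm)
  then show "(x has_vector_derivative vderiv_on J 1 x s) (at s within J)"
    "(vderiv_on J 1 x has_vector_derivative vderiv_on J 2 x s) (at s within J)"
    using assms(2) by (auto simp: differentiable_on_def vector_derivative_works numeral_2_eq_2)
qed

lemma compact_op_bounded_linear:
  assumes "compact_op f"
  shows "bounded_linear f"
proof -
  have lin: "linear f" and "compact (closure (f ` cball 0 1))" using assms by (auto simp: compact_op_def)
  then have "bounded (f ` cball 0 1)" using compact_imp_bounded bounded_subset closure_subset by blast
  then obtain K where "\<forall>v\<in>f ` cball 0 1. norm v \<le> K" unfolding bounded_iff by blast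
  then have K: "norm (f u) \<le> K" if "norm u \<le> 1" for u using that by auto
  have "norm (f u) \<le> norm u * K" for u
  proof (cases "u = 0")
    case False
    have "f u = norm u *\<^sub>R f ((1 / norm u) *\<^sub>R u)" using False lin by (simp add: linear_scale)
    then have "norm (f u) = norm u * norm (f ((1 / norm u) *\<^sub>R u))" by (metis abs_norm_cancel norm_scaleR)
    also have "\<dots> \<le> norm u * K" using False by (intro mult_left_mono K) auto
    finally show ?thesis .
  qed (use lin linear_0 in fastforce)
  then show ?thesis using lin by (intro bounded_linear_intro) (auto simp: linear_add linear_scale)
qed

lemma linear_op_compose:
  assumes f: "linear_op D f" and h: "linear h" "\<And>u. h u \<in> D"
  shows "linear (\<lambda>u. f (h u))"
  using assms by (intro linearI) (auto simp: linear_op_def linear_add linear_scale)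

text \<open>
  A closed operator after an everywhere defined bounded operator with values in its domain is closed and
  everywhere defined, so the closed graph theorem applies.
\<close>

lemma closed_op_compose_bounded_linear:
  fixes h :: "'y::banach \<Rightarrow> 'x::banach" and f :: "'x \<Rightarrow> 'z::banach"
  assumes f: "linear_op D f" "closed_op D f" and h: "bounded_linear h" "\<And>u. h u \<in> D"
  shows "bounded_linear (\<lambda>u. f (h u))"
proof (rule closed_graph_bounded_linear)
  show "linear (\<lambda>u. f (h u))" by (rule linear_op_compose[OF f(1) bounded_linear.linear[OF h(1)] h(2)])
  fix X x y assume "X \<longlonglongrightarrow> x" and y: "(\<lambda>n. f (h (X n))) \<longlonglongrightarrow> y"
  then have "(\<lambda>n. h (X n)) \<longlonglongrightarrow> h x" by (intro bounded_linear.tendsto[OF h(1)])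
  then have "(\<lambda>n. (h (X n), f (h (X n)))) \<longlonglongrightarrow> (h x, y)" using y by (rule tendsto_Pair)
  moreover have "\<And>n. (h (X n), f (h (X n))) \<in> {(x, f x) | x. x \<in> D}" using h(2) by auto
  ultimately have "(h x, y) \<in> {(x, f x) | x. x \<in> D}"
    using closed_sequentially[OF f(2)[unfolded closed_op_def], of "\<lambda>n. (h (X n), f (h (X n)))" "(h x, y)"]
    by simp
  then show "f (h x) = y" by auto
qed

lemma bounded_op_compose_bounded_linear:
  assumes f: "linear_op D f" "bounded_op D f" and h: "bounded_linear h" "\<And>u. h u \<in> D"
  shows "bounded_linear (\<lambda>u. f (h u))"
proof -
  obtain C where C: "\<forall>x\<in>D. norm (f x) \<le> C * norm x" using f(2) by (auto simp: bounded_op_def)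
  obtain K where K: "\<And>u. norm (h u) \<le> norm u * K" using bounded_linear.bounded[OF h(1)] by blast
  interpret linear "\<lambda>u. f (h u)" by (rule linear_op_compose[OF f(1) bounded_linear.linear[OF h(1)] h(2)])
  show ?thesis
  proof (rule bounded_linear_intro[where K="\<bar>C\<bar> * K"])
    fix u
    have "norm (f (h u)) \<le> C * norm (h u)" using C h(2) by blast
    also have "\<dots> \<le> \<bar>C\<bar> * norm (h u)" by (intro mult_right_mono) auto
    also have "\<dots> \<le> \<bar>C\<bar> * (norm u * K)" by (intro mult_left_mono K) auto
    finally show "norm (f (h u)) \<le> norm u * (\<bar>C\<bar> * K)" by (simp add: mult_ac)
  qed (simp_all add: add scale)
qed

section \<open>The representation of mild solutions\<close>

theorem theorem4p4:
  fixes DE DA DB :: "'x::banach set"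
    and E A0 B0 :: "'x \<Rightarrow> 'y::banach"
    and Einv :: "'y \<Rightarrow>\<^sub>L 'x" and A B :: "'y \<Rightarrow>\<^sub>L 'y"
    and \<alpha> \<beta> T :: real and \<eta> \<eta>' :: 'y
    and g :: "real \<Rightarrow> 'y" and y :: "real \<Rightarrow> 'x"
  assumes "linear_op DE E" and "linear_op DA A0" and "linear_op DB B0"
    and "closed_op DA A0"
    and "bounded_op DB B0"
    and "DE \<subseteq> DA" and "DE \<subseteq> DB" and "bij_betw E DE UNIV"
    and "compact_op (inv_into DE E)"
    and Einv: "Einv = Blinfun (inv_into DE E)"
    and A: "A = Blinfun (\<lambda>u. A0 (inv_into DE E u))"
    and B: "B = Blinfun (\<lambda>u. B0 (inv_into DE E u))"
    and "(A o\<^sub>L B) - (B o\<^sub>L A) = 0"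
    and "0 < T" and "1 < \<alpha>" and "\<alpha> \<le> 2" and "0 < \<beta>" and "\<beta> \<le> 1"
    and "continuous_on {0..T} g"
    and "Ck_on 2 {0..T} y"
    and "mild_solution T \<alpha> \<beta> DE E A0 B0 g \<eta> \<eta>' y"
  shows
    "bounded_linear (inv_into DE E) \<and>
     bounded_linear (\<lambda>u. A0 (inv_into DE E u)) \<and>
     bounded_linear (\<lambda>u. B0 (inv_into DE E u)) \<and>
     (\<forall>t\<in>{0..T}. \<forall>c\<in>{\<alpha> + 1, 2, \<alpha>}.
        summable2 (mittag_leffler_term (\<alpha> - \<beta>) \<alpha> c (t powr (\<alpha> - \<beta>) *\<^sub>R A) (t powr \<alpha> *\<^sub>R B))) \<and>
     (\<forall>t\<in>{0<..T}.
        bochner_integrable (lebesgue_on {0..t})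
          (\<lambda>s. blinfun_apply ((t - s) powr (\<alpha> - 1) *\<^sub>R
             (Einv o\<^sub>L mittag_leffler (\<alpha> - \<beta>) \<alpha> \<alpha> ((t - s) powr (\<alpha> - \<beta>) *\<^sub>R A) ((t - s) powr \<alpha> *\<^sub>R B))) (g s)) \<and>
        y t =
          blinfun_apply
            (Einv + t powr \<alpha> *\<^sub>R
               (Einv o\<^sub>L B o\<^sub>L mittag_leffler (\<alpha> - \<beta>) \<alpha> (\<alpha> + 1) (t powr (\<alpha> - \<beta>) *\<^sub>R A) (t powr \<alpha> *\<^sub>R B))) \<eta>
        + blinfun_apply
            (t *\<^sub>R (Einv o\<^sub>L mittag_leffler (\<alpha> - \<beta>) \<alpha> 2 (t powr (\<alpha> - \<beta>) *\<^sub>R A) (t powr \<alpha> *\<^sub>R B))) \<eta>'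
        + laplace_conv
            (\<lambda>r. r powr (\<alpha> - 1) *\<^sub>R
               (Einv o\<^sub>L mittag_leffler (\<alpha> - \<beta>) \<alpha> \<alpha> (r powr (\<alpha> - \<beta>) *\<^sub>R A) (r powr \<alpha> *\<^sub>R B))) g t) \<and>
     (\<forall>t\<in>{0<..T}.
        let S1 = (\<lambda>k m. (real ((k + m) choose m) * t powr (real k * (\<alpha> - \<beta>) + real m * \<alpha> + \<alpha>)
                     / Gamma (real k * (\<alpha> - \<beta>) + real m * \<alpha> + \<alpha> + 1)) *\<^sub>R
                   (Einv o\<^sub>L blinfun_pow A k o\<^sub>L blinfun_pow B (m + 1)));
            S2 = (\<lambda>k m. (real ((k + m) choose m) * t powr (real k * (\<alpha> - \<beta>) + real m * \<alpha> + 1)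
                     / Gamma (real k * (\<alpha> - \<beta>) + real m * \<alpha> + 2)) *\<^sub>R
                   blinfun_apply (Einv o\<^sub>L blinfun_pow A k o\<^sub>L blinfun_pow B m) \<eta>');
            S3 = (\<lambda>s k m. (real ((k + m) choose m) * (t - s) powr (real k * (\<alpha> - \<beta>) + real m * \<alpha> + \<alpha> - 1)
                     / Gamma (real k * (\<alpha> - \<beta>) + real m * \<alpha> + \<alpha>)) *\<^sub>R
                   blinfun_apply (Einv o\<^sub>L blinfun_pow A k o\<^sub>L blinfun_pow B m) (g s))
        in summable2 S1 \<and> summable2 S2 \<and> (\<forall>s\<in>{0..t}. summable2 (S3 s)) \<and>
           bochner_integrable (lebesgue_on {0..t}) (\<lambda>s. suminf2 (S3 s)) \<and>
           y t = blinfun_apply (Einv + suminf2 S1) \<eta> + suminf2 S2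
                 + bochner_integral (lebesgue_on {0..t}) (\<lambda>s. suminf2 (S3 s)))"
proof -
  let ?R = "inv_into DE E"
  let ?mlf = "\<lambda>c r. mittag_leffler (\<alpha> - \<beta>) \<alpha> c (r powr (\<alpha> - \<beta>) *\<^sub>R A) (r powr \<alpha> *\<^sub>R B)"
  note linE = assms(1) and linA = assms(2) and linB = assms(3) and closedA = assms(4) and boundedB = assms(5)
    and DEA = assms(6) and DEB = assms(7) and bijE = assms(8) and compactR = assms(9) and comm0 = assms(13)
    and T = assms(14) and \<alpha> = assms(15,16) and \<beta> = assms(17,18) and g = assms(19) and mild = assms(21)
  have RD: "?R u \<in> DE" for u using bijE by (simp add: bij_betw_def inv_into_into)
  have bR: "bounded_linear ?R" by (rule compact_op_bounded_linear[OF compactR])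
  have bA: "bounded_linear (\<lambda>u. A0 (?R u))"
    using DEA RD by (intro closed_op_compose_bounded_linear[OF linA closedA bR]) blast
  have bB: "bounded_linear (\<lambda>u. B0 (?R u))"
    using DEB RD by (intro bounded_op_compose_bounded_linear[OF linB boundedB bR]) blast
  have Einv_apply: "blinfun_apply Einv u = ?R u" for u
    unfolding Einv by (simp add: bounded_linear_Blinfun_apply[OF bR])
  have A_apply: "blinfun_apply A u = A0 (?R u)" for u
    unfolding A by (simp add: bounded_linear_Blinfun_apply[OF bA])
  have B_apply: "blinfun_apply B u = B0 (?R u)" for u
    unfolding B by (simp add: bounded_linear_Blinfun_apply[OF bB])
  have comm: "blinfun_apply A (blinfun_apply B u) = blinfun_apply B (blinfun_apply A u)" for u
  proof -
    have "A o\<^sub>L B = B o\<^sub>L A" using comm0 by simp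
    then have "blinfun_apply (A o\<^sub>L B) u = blinfun_apply (B o\<^sub>L A) u" by simp
    then show ?thesis by simp
  qed
  have a: "0 < \<alpha> - \<beta>" and \<alpha>0: "0 < \<alpha>" using \<alpha> \<beta> by auto

  from mild obtain x where x: "Ck_on 2 {0..T} x" and yx: "\<And>t. t \<in> {0..T} \<Longrightarrow> y t = ?R (x t)"
    and eq: "\<And>t. t \<in> {0<..T} \<Longrightarrow> caputo T \<alpha> x t - A0 (?R (caputo T \<beta> x t)) = B0 (?R (x t)) + g t"
    and x0: "x 0 = \<eta>" and x1: "vderiv_on {0..T} 1 x 0 = \<eta>'"
    unfolding mild_solution_def by blast
  note x' = Ck_on_2_has_vector_derivative(1)[OF x]
  note x'' = Ck_on_2_has_vector_derivative(2)[OF x]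
  have c'': "continuous_on {0..T} (vderiv_on {0..T} 2 x)" using x by (simp add: Ck_on_def)
  have cx: "continuous_on {0..T} x" by (rule continuous_on_vector_derivative, erule x')
  have "nat \<lceil>\<alpha>\<rceil> = 2" "nat \<lceil>\<beta>\<rceil> = 1"
  proof -
    have "\<lceil>\<alpha>\<rceil> = 2" "\<lceil>\<beta>\<rceil> = 1" using \<alpha> \<beta> by (auto simp: ceiling_eq_iff)
    then show "nat \<lceil>\<alpha>\<rceil> = 2" "nat \<lceil>\<beta>\<rceil> = 1" by auto
  qed
  then have ca: "caputo T \<alpha> x t = frac_int (2 - \<alpha>) (vderiv_on {0..T} 2 x) t"
    and cb: "caputo T \<beta> x t = frac_int (1 - \<beta>) (vderiv_on {0..T} 1 x) t" for t
    by (simp_all add: caputo_eq_frac_int)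
  have volterra: "x s - \<eta> - s *\<^sub>R \<eta>' = A (frac_int (\<alpha> - \<beta>) x s) - A (frac_int (\<alpha> - \<beta>) (\<lambda>_. \<eta>) s)
      + B (frac_int \<alpha> x s) + frac_int \<alpha> g s" if "s \<in> {0..T}" for s
    using fractional_cauchy_volterra[OF x' x'' c'' g T \<alpha> \<beta> _ that, of A B] eq
    unfolding x0 x1 by (simp add: ca cb A_apply B_apply)
  have formula: "x t = \<eta> + B ((t powr \<alpha> *\<^sub>R ?mlf (\<alpha> + 1) t) \<eta>) + (t *\<^sub>R ?mlf 2 t) \<eta>'
      + resolvent (\<alpha> - \<beta>) \<alpha> A B (frac_int \<alpha> g) t" if t: "0 < t" "t \<le> T" for t
    using volterra_solution_initial_data[OF comm cx g a \<alpha>0 t volterra]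
    unfolding resolvent_initial_value[OF comm a \<alpha>0 t] resolvent_initial_slope[OF a \<alpha>0 t(1)] .

  define K where "K t s = ((t - s) powr (\<alpha> - 1) *\<^sub>R (Einv o\<^sub>L ?mlf \<alpha> (t - s))) (g s)" for t s
  \<comment> \<open>The convolution integral commutes with the bounded operator Einv.\<close>
  have hbK: "has_bochner (lebesgue_on {0..t}) (K t) (Einv (resolvent (\<alpha> - \<beta>) \<alpha> A B (frac_int \<alpha> g) t))"
    if t: "0 < t" "t \<le> T" for t
    using has_bochner_bounded_linear[OF blinfun.bounded_linear_right has_bochner_resolvent[OF g a \<alpha>(1) t, of A B], of Einv]
    by (simp add: K_def[abs_def] blinfun.scaleR_left blinfun.scaleR_right)
  note intK = bochner_integral_eq[OF hbK]
  have intgK: "bochner_integrable (lebesgue_on {0..t}) (K t)" if "0 < t" "t \<le> T" for t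
    using hbK[OF that] by (auto simp: bochner_integrable_def)
  have closed_form: "y t = (Einv + t powr \<alpha> *\<^sub>R (Einv o\<^sub>L B o\<^sub>L ?mlf (\<alpha> + 1) t)) \<eta>
      + (t *\<^sub>R (Einv o\<^sub>L ?mlf 2 t)) \<eta>' + bochner_integral (lebesgue_on {0..t}) (K t)"
    if t: "0 < t" "t \<le> T" for t
  proof -
    have "y t = Einv (x t)" using yx[of t] t by (simp add: Einv_apply)
    then show ?thesis
      unfolding intK[OF t] formula[OF t]
      by (simp add: blinfun.add_left blinfun.add_right blinfun.scaleR_left blinfun.scaleR_right)
  qed

  \<comment> \<open>The factor B in front of the series commutes with the powers of A and
    raises the exponent of B by one.\<close>
  have series1: "summable2 (\<lambda>k m. (real ((k + m) choose m) * t powr (real k * (\<alpha> - \<beta>) + real m * \<alpha> + \<alpha>)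
        / Gamma (real k * (\<alpha> - \<beta>) + real m * \<alpha> + \<alpha> + 1)) *\<^sub>R (Einv o\<^sub>L blinfun_pow A k o\<^sub>L blinfun_pow B (m + 1)))"
      (is "summable2 ?S1")
    and sum1: "suminf2 (\<lambda>k m. (real ((k + m) choose m) * t powr (real k * (\<alpha> - \<beta>) + real m * \<alpha> + \<alpha>)
        / Gamma (real k * (\<alpha> - \<beta>) + real m * \<alpha> + \<alpha> + 1)) *\<^sub>R (Einv o\<^sub>L blinfun_pow A k o\<^sub>L blinfun_pow B (m + 1)))
      = t powr \<alpha> *\<^sub>R (Einv o\<^sub>L B o\<^sub>L ?mlf (\<alpha> + 1) t)" if t: "0 < t" for t
  proof -
    let ?L = "\<lambda>X. Einv o\<^sub>L B o\<^sub>L X"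
    have L: "bounded_linear ?L"
      by (rule bounded_bilinear.bounded_linear_right[OF bounded_bilinear_blinfun_compose])
    have "?L (blinfun_pow A k o\<^sub>L blinfun_pow B m) = Einv o\<^sub>L blinfun_pow A k o\<^sub>L blinfun_pow B (m + 1)" for k m
      by (rule blinfun_eqI) (simp add: blinfun_pow_commute[OF comm])
    then have S1: "?L (scaled_term (\<alpha> - \<beta>) \<alpha> (\<alpha> + 1) \<alpha> A B t k m) = ?S1 k m" for k m
      by (simp add: scaled_term_def linear_scale[OF bounded_linear.linear[OF L]] add.assoc)
    show "summable2 ?S1" "suminf2 ?S1 = t powr \<alpha> *\<^sub>R (Einv o\<^sub>L B o\<^sub>L ?mlf (\<alpha> + 1) t)"
      using apply_scaled_mittag_leffler[OF _ a \<alpha>0 \<alpha>0 _ L, of t "\<alpha> + 1" A B] t \<alpha>0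
      by (simp_all add: S1 linear_scale[OF bounded_linear.linear[OF L]])
  qed
  have vector_series: "summable2 (\<lambda>k m. (real ((k + m) choose m) * r powr (real k * (\<alpha> - \<beta>) + real m * \<alpha> + d)
        / Gamma (real k * (\<alpha> - \<beta>) + real m * \<alpha> + c)) *\<^sub>R (Einv o\<^sub>L blinfun_pow A k o\<^sub>L blinfun_pow B m) u)"
    and vector_sum: "suminf2 (\<lambda>k m. (real ((k + m) choose m) * r powr (real k * (\<alpha> - \<beta>) + real m * \<alpha> + d)
        / Gamma (real k * (\<alpha> - \<beta>) + real m * \<alpha> + c)) *\<^sub>R (Einv o\<^sub>L blinfun_pow A k o\<^sub>L blinfun_pow B m) u)
      = (r powr d *\<^sub>R (Einv o\<^sub>L ?mlf c r)) u" if "0 \<le> r" "0 < d" "1 \<le> c" for r c d u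
  proof -
    have L: "bounded_linear (\<lambda>X. Einv (blinfun_apply X u))"
      by (rule bounded_linear_compose[OF blinfun.bounded_linear_right blinfun.bounded_linear_left])
    from apply_scaled_mittag_leffler[OF that(1) a \<alpha>0 that(2,3) L, of A B]
    show "summable2 (\<lambda>k m. (real ((k + m) choose m) * r powr (real k * (\<alpha> - \<beta>) + real m * \<alpha> + d)
        / Gamma (real k * (\<alpha> - \<beta>) + real m * \<alpha> + c)) *\<^sub>R (Einv o\<^sub>L blinfun_pow A k o\<^sub>L blinfun_pow B m) u)"
      "suminf2 (\<lambda>k m. (real ((k + m) choose m) * r powr (real k * (\<alpha> - \<beta>) + real m * \<alpha> + d)
        / Gamma (real k * (\<alpha> - \<beta>) + real m * \<alpha> + c)) *\<^sub>R (Einv o\<^sub>L blinfun_pow A k o\<^sub>L blinfun_pow B m) u)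
      = (r powr d *\<^sub>R (Einv o\<^sub>L ?mlf c r)) u"
      by (simp_all add: scaled_term_def blinfun.scaleR_left blinfun.scaleR_right)
  qed
  show ?thesis
  proof (intro conjI ballI bR bA bB)
    fix t c assume "t \<in> {0..T}" "c \<in> {\<alpha> + 1, 2, \<alpha>}"
    then have "1 \<le> c" using \<alpha> by auto
    then show "summable2 (mittag_leffler_term (\<alpha> - \<beta>) \<alpha> c (t powr (\<alpha> - \<beta>) *\<^sub>R A) (t powr \<alpha> *\<^sub>R B))"
      by (rule mittag_leffler_summable2[OF a \<alpha>0])
  next
    fix t assume "t \<in> {0<..T}"
    then have t: "0 < t" "t \<le> T" by auto
    show "bochner_integrable (lebesgue_on {0..t})
          (\<lambda>s. blinfun_apply ((t - s) powr (\<alpha> - 1) *\<^sub>R (Einv o\<^sub>L ?mlf \<alpha> (t - s))) (g s))"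
      using intgK[OF t] by (simp only: K_def[abs_def])
    show "y t = blinfun_apply (Einv + t powr \<alpha> *\<^sub>R (Einv o\<^sub>L B o\<^sub>L ?mlf (\<alpha> + 1) t)) \<eta>
        + blinfun_apply (t *\<^sub>R (Einv o\<^sub>L ?mlf 2 t)) \<eta>'
        + laplace_conv (\<lambda>r. r powr (\<alpha> - 1) *\<^sub>R (Einv o\<^sub>L ?mlf \<alpha> r)) g t"
      using closed_form[OF t] by (simp only: K_def[abs_def] laplace_conv_def)
  next
    fix t assume "t \<in> {0<..T}"
    then have t: "0 < t" "t \<le> T" by auto
    let ?S2 = "\<lambda>k m. (real ((k + m) choose m) * t powr (real k * (\<alpha> - \<beta>) + real m * \<alpha> + 1)
        / Gamma (real k * (\<alpha> - \<beta>) + real m * \<alpha> + 2)) *\<^sub>R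
        blinfun_apply (Einv o\<^sub>L blinfun_pow A k o\<^sub>L blinfun_pow B m) \<eta>'"
    let ?S3 = "\<lambda>s k m. (real ((k + m) choose m) * (t - s) powr (real k * (\<alpha> - \<beta>) + real m * \<alpha> + \<alpha> - 1)
        / Gamma (real k * (\<alpha> - \<beta>) + real m * \<alpha> + \<alpha>)) *\<^sub>R
        blinfun_apply (Einv o\<^sub>L blinfun_pow A k o\<^sub>L blinfun_pow B m) (g s)"
    have S2: "summable2 ?S2" "suminf2 ?S2 = (t *\<^sub>R (Einv o\<^sub>L ?mlf 2 t)) \<eta>'"
      using vector_series[of t 1 2 \<eta>'] vector_sum[of t 1 2 \<eta>'] t by simp_all
    have S3: "summable2 (?S3 s)" "suminf2 (?S3 s) = K t s" if "s \<in> {0..t}" for s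
      using vector_series[of "t - s" "\<alpha> - 1" \<alpha> "g s"] vector_sum[of "t - s" "\<alpha> - 1" \<alpha> "g s"] that \<alpha>
      by (simp_all add: K_def add_diff_eq)
    have hb3: "has_bochner (lebesgue_on {0..t}) (\<lambda>s. suminf2 (?S3 s)) I
        \<longleftrightarrow> has_bochner (lebesgue_on {0..t}) (K t) I" for I
      by (rule has_bochner_cong, rule S3(2)) simp
    have int3: "bochner_integral (lebesgue_on {0..t}) (\<lambda>s. suminf2 (?S3 s)) = bochner_integral (lebesgue_on {0..t}) (K t)"
      by (rule bochner_integral_cong, rule S3(2)) simp
    have intg3: "bochner_integrable (lebesgue_on {0..t}) (\<lambda>s. suminf2 (?S3 s))"
      using intgK[OF t] unfolding bochner_integrable_def hb3 .
    show "let S1 = (\<lambda>k m. (real ((k + m) choose m) * t powr (real k * (\<alpha> - \<beta>) + real m * \<alpha> + \<alpha>)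
                     / Gamma (real k * (\<alpha> - \<beta>) + real m * \<alpha> + \<alpha> + 1)) *\<^sub>R
                   (Einv o\<^sub>L blinfun_pow A k o\<^sub>L blinfun_pow B (m + 1)));
            S2 = ?S2; S3 = ?S3
        in summable2 S1 \<and> summable2 S2 \<and> (\<forall>s\<in>{0..t}. summable2 (S3 s)) \<and>
           bochner_integrable (lebesgue_on {0..t}) (\<lambda>s. suminf2 (S3 s)) \<and>
           y t = blinfun_apply (Einv + suminf2 S1) \<eta> + suminf2 S2
                 + bochner_integral (lebesgue_on {0..t}) (\<lambda>s. suminf2 (S3 s))"
      unfolding Let_def sum1[OF t(1)] S2(2) int3
      by (intro conjI ballI series1[OF t(1)] S2(1) S3(1) intg3 closed_form[OF t])
  qed
qed

end
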